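(* Assume the setting described in the context. Let $\alpha:X\multimap\overline{F_\tau}X$ satisfy $[\nu_X,e_X]\cdot m'_X\cdot\overline{F_\tau}\alpha\le m_X\cdot\overline{F}^{*}\underline{\alpha}\cdot[\nu_X,e_X]$. Then every bisimulation on the $TF_\tau$-coalgebra $\alpha^{\bigstar}:X\to TF_\tau X$ is a bisimulation on the $TF^*$-coalgebra $\underline{\alpha}^{\divideontimes}:X\to TF^*X$.
   Context: Let $\mathsf{C}$ be a category with binary coproducts and $(T,\mu,\eta)$ a monad on $\mathsf{C}$. In the Kleisli category $\mathcal{K}l(T)$ (objects of $\mathsf{C}$; morphisms $X\multimap Y$ are $\mathsf{C}$-morphisms $X\to TY$; composition $g\cdot f=\mu_Z\circ Tg\circ f$; identity $1_X=\eta_X$) write $f^\sharp=\eta_Y\circ f$ for $f:X\to Y$ in $\mathsf{C}$; coproducts of $\mathcal{K}l(T)$ are those of $\mathsf{C}$, with coprojections $\iota^1,\iota^2$ and cotupling $[-,-]$. $\mathcal{K}l(T)$ is order-enriched (hom-sets are posets, composition monotone) and $T$ is an order saturation monad: for every $\alpha:X\multimap X$ there is $\alpha^{*}:X\multimap X$ with (a) $1\le\alpha^*$, (b) $\alpha\le\alpha^*$, (c) $\alpha^*\cdot\alpha^*\le\alpha^*$, (d) if $\beta:X\multimap X$ satisfies $1\le\beta$, $\alpha\le\beta$, $\beta\cdot\beta\le\beta$ then $\alpha^*\le\beta$, (e) for all $f:X\to Y$ in $\mathsf{C}$, $\beta:Y\multimap Y$ and $\Box\in\{\le,\ge\}$: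 $f^\sharp\cdot\alpha\mathrel{\Box}\beta\cdot f^\sharp$ implies $f^\sharp\cdot\alpha^*\mathrel{\Box}\beta^*\cdot f^\sharp$. A functor $S$ on $\mathsf{C}$ lifts to $\overline{S}$ on $\mathcal{K}l(T)$ if $\overline{S}X=SX$ and $\overline{S}(f^\sharp)=(Sf)^\sharp$; if $(\overline{S},m,e)$ is a monad on $\mathcal{K}l(T)$ then $TS$ is a monad on $\mathsf{C}$ whose Kleisli category is $\mathcal{K}l(\overline{S})$, with hom-sets $Hom_{\mathcal{K}l(T)}(X,\overline{S}Y)$ ordered as in $\mathcal{K}l(T)$. Standing assumptions: $\mathcal{K}l(T)$ has zero morphisms $0_{X,Y}$ (with $f\cdot 0=0=0\cdot g$). $F:\mathsf{C}\to\mathsf{C}$ lifts to $\overline{F}$, so $F_\tau=F+\mathcal{I}d$ lifts to $\overline{F_\tau}=\overline{F}+\mathcal{I}d$, which is a monad $(\overline{F_\tau},m',e')$ on $\mathcal{K}l(T)$ with $e'_X=\iota^2:X\multimap\overline{F}X+X$ and $m'_X=[\iota^1,id]\cdot(\overline{F}([0,id])+id):\overline{F}(\overline{F}X+X)+(\overline{F}X+X)\multimap\overline{F}X+X$. $F$ admits all free $F$-algebras, giving the free monad $F^*$ on $\mathsf{C}$; it lifts to $\overline{F}^*$ on $\mathcal{K}l(T)$ and $(\overline{F}^*,m,e)$ is the free monad over $\overline{F}$ in $\mathcal{K}l(T)$ with universal natural transformation $\nu:\overline{F}\Rightarrow\overline{F}^*$. For both $(\overline{S},m,e)=(\overline{F_\tau},m',e')$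 and $(\overline{S},m,e)=(\overline{F}^*,m,e)$, $\overline{S}$ is locally monotonic and $m_X\cdot\overline{S}[(m_X\cdot\overline{S}\alpha)^*\cdot e_X]=(m_X\cdot\overline{S}\alpha)^*$ for all $\alpha:X\multimap\overline{S}X$. For $\alpha:X\multimap\overline{F_\tau}X$ put $\alpha^{\bigstar}=(m'_X\cdot\overline{F_\tau}\alpha)^*\cdot e'_X$, and for $\beta:Y\multimap\overline{F}^*Y$ put $\beta^{\divideontimes}=(m_Y\cdot\overline{F}^*\beta)^*\cdot e_Y$ (these are saturation operators making $TF_\tau$ and $TF^*$ order saturation monads). For $\alpha:X\multimap\overline{F_\tau}X$ let $\underline{\alpha}=[\nu_X,e_X]\cdot\alpha:X\multimap\overline{F}^*X$; the order is that of $\mathcal{K}l(T)$. Bisimulation (kernel bisimulation): for an endofunctor $G$ on $\mathsf{C}$ and $G$-coalgebras $\alpha:X\to GX$, $\beta:Y\to GY$, a jointly monic span $X\xleftarrow{\pi_1}R\xrightarrow{\pi_2}Y$ is a bisimulation if there exist a $G$-coalgebra $\gamma:Z\to GZ$ and coalgebra homomorphisms $f$ from $\alpha$ to $\gamma$ and $g$ from $\beta$ to $\gamma$ (i.e. $Gf\circ\alpha=\gamma\circ f$, $Gg\circ\beta=\gamma\circ g$) such that $(R,\pi_1,\pi_2)$ is the pullback of $X\xrightarrow{f}Z\xleftarrow{g}Y$. A bisimulation on a coalgebra is a bisimulation between it and itself. *)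

theory Defs
  imports Main
begin

section \<open>Categories, endofunctors, monads\<close>

record ('o, 'a) category =
  Ob :: "'o set"
  Ar :: "'a set"
  Dom :: "'a \<Rightarrow> 'o"
  Cod :: "'a \<Rightarrow> 'o"
  Idt :: "'o \<Rightarrow> 'a"
  Comp :: "'a \<Rightarrow> 'a \<Rightarrow> 'a"  (infixr "\<cdot>\<index>" 70)

definition hom :: "('o, 'a) category \<Rightarrow> 'o \<Rightarrow> 'o \<Rightarrow> 'a set" where
  "hom C X Y = {f \<in> Ar C. Dom C f = X \<and> Cod C f = Y}"

locale category =
  fixes C :: "('o, 'a) category" (structure)
  assumes Dom_Ob: "f \<in> Ar C \<Longrightarrow> Dom C f \<in> Ob C"
    and Cod_Ob: "f \<in> Ar C \<Longrightarrow> Cod C f \<in> Ob C"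
    and Idt_hom: "X \<in> Ob C \<Longrightarrow> Idt C X \<in> hom C X X"
    and Comp_hom: "f \<in> hom C X Y \<Longrightarrow> g \<in> hom C Y Z \<Longrightarrow> g \<cdot> f \<in> hom C X Z"
    and Comp_assoc: "f \<in> hom C W X \<Longrightarrow> g \<in> hom C X Y \<Longrightarrow> h \<in> hom C Y Z
      \<Longrightarrow> (h \<cdot> g) \<cdot> f = h \<cdot> (g \<cdot> f)"
    and Idt_left: "f \<in> hom C X Y \<Longrightarrow> Idt C Y \<cdot> f = f"
    and Idt_right: "f \<in> hom C X Y \<Longrightarrow> f \<cdot> Idt C X = f"

record ('o, 'a) endo =
  omap :: "'o \<Rightarrow> 'o"
  amap :: "'a \<Rightarrow> 'a"

locale endofunctor = category C
  for C :: "('o, 'a) category" (structure) +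
  fixes F :: "('o, 'a, 'm) endo_scheme"
  assumes omap_Ob: "X \<in> Ob C \<Longrightarrow> omap F X \<in> Ob C"
    and amap_hom: "f \<in> hom C X Y \<Longrightarrow> amap F f \<in> hom C (omap F X) (omap F Y)"
    and amap_Idt: "X \<in> Ob C \<Longrightarrow> amap F (Idt C X) = Idt C (omap F X)"
    and amap_Comp: "f \<in> hom C X Y \<Longrightarrow> g \<in> hom C Y Z
      \<Longrightarrow> amap F (g \<cdot> f) = amap F g \<cdot> amap F f"

definition comp_endo :: "('o, 'a, 'm) endo_scheme \<Rightarrow> ('o, 'a, 'n) endo_scheme \<Rightarrow> ('o, 'a) endo" where
  "comp_endo G F = \<lparr>omap = (\<lambda>X. omap G (omap F X)), amap = (\<lambda>f. amap G (amap F f))\<rparr>"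

definition natural :: "('o, 'a) category \<Rightarrow> ('o, 'a, 'm) endo_scheme \<Rightarrow> ('o, 'a, 'n) endo_scheme
    \<Rightarrow> ('o \<Rightarrow> 'a) \<Rightarrow> bool" where
  "natural C F G \<sigma> \<longleftrightarrow>
     (\<forall>X\<in>Ob C. \<sigma> X \<in> hom C (omap F X) (omap G X)) \<and>
     (\<forall>X Y f. f \<in> hom C X Y \<longrightarrow> \<sigma> Y \<cdot>\<^bsub>C\<^esub> amap F f = amap G f \<cdot>\<^bsub>C\<^esub> \<sigma> X)"

record ('o, 'a) monad = "('o, 'a) endo" +
  mult :: "'o \<Rightarrow> 'a"
  munit :: "'o \<Rightarrow> 'a"

locale monad = endofunctor C T
  for C :: "('o, 'a) category" (structure) and T :: "('o, 'a) monad" +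
  assumes munit_natural: "natural C \<lparr>omap = (\<lambda>X. X), amap = (\<lambda>f. f)\<rparr> T (munit T)"
    and mult_natural: "natural C (comp_endo T T) T (mult T)"
    and mult_assoc: "X \<in> Ob C \<Longrightarrow> mult T X \<cdot> amap T (mult T X) = mult T X \<cdot> mult T (omap T X)"
    and munit_left: "X \<in> Ob C \<Longrightarrow> mult T X \<cdot> munit T (omap T X) = Idt C (omap T X)"
    and munit_right: "X \<in> Ob C \<Longrightarrow> mult T X \<cdot> amap T (munit T X) = Idt C (omap T X)"

definition monad_morphism :: "('o, 'a) category \<Rightarrow> ('o, 'a) monad \<Rightarrow> ('o, 'a) monad
    \<Rightarrow> ('o \<Rightarrow> 'a) \<Rightarrow> bool" where
  "monad_morphism C M N \<sigma> \<longleftrightarrow>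
     natural C M N \<sigma> \<and>
     (\<forall>X\<in>Ob C. \<sigma> X \<cdot>\<^bsub>C\<^esub> munit M X = munit N X) \<and>
     (\<forall>X\<in>Ob C. \<sigma> X \<cdot>\<^bsub>C\<^esub> mult M X = mult N X \<cdot>\<^bsub>C\<^esub> amap N (\<sigma> X) \<cdot>\<^bsub>C\<^esub> \<sigma> (omap M X))"


section \<open>Binary coproducts\<close>

record ('o, 'a) coproducts =
  csum :: "'o \<Rightarrow> 'o \<Rightarrow> 'o"
  inj1 :: "'o \<Rightarrow> 'o \<Rightarrow> 'a"
  inj2 :: "'o \<Rightarrow> 'o \<Rightarrow> 'a"

locale binary_coproducts = category C
  for C :: "('o, 'a) category" (structure) +
  fixes P :: "('o, 'a) coproducts"
  assumes csum_Ob: "X \<in> Ob C \<Longrightarrow> Y \<in> Ob C \<Longrightarrow> csum P X Y \<in> Ob C"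
    and inj1_hom: "X \<in> Ob C \<Longrightarrow> Y \<in> Ob C \<Longrightarrow> inj1 P X Y \<in> hom C X (csum P X Y)"
    and inj2_hom: "X \<in> Ob C \<Longrightarrow> Y \<in> Ob C \<Longrightarrow> inj2 P X Y \<in> hom C Y (csum P X Y)"
    and csum_universal: "f \<in> hom C X Z \<Longrightarrow> g \<in> hom C Y Z
      \<Longrightarrow> \<exists>!h. h \<in> hom C (csum P X Y) Z \<and> h \<cdot> inj1 P X Y = f \<and> h \<cdot> inj2 P X Y = g"

definition cotuple :: "('o, 'a) category \<Rightarrow> ('o, 'a) coproducts \<Rightarrow> 'a \<Rightarrow> 'a \<Rightarrow> 'a" where
  "cotuple C P f g =
     (THE h. h \<in> hom C (csum P (Dom C f) (Dom C g)) (Cod C f) \<and>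
             h \<cdot>\<^bsub>C\<^esub> inj1 P (Dom C f) (Dom C g) = f \<and>
             h \<cdot>\<^bsub>C\<^esub> inj2 P (Dom C f) (Dom C g) = g)"

definition sum_map :: "('o, 'a) category \<Rightarrow> ('o, 'a) coproducts \<Rightarrow> 'a \<Rightarrow> 'a \<Rightarrow> 'a" where
  "sum_map C P f g =
     cotuple C P (inj1 P (Cod C f) (Cod C g) \<cdot>\<^bsub>C\<^esub> f) (inj2 P (Cod C f) (Cod C g) \<cdot>\<^bsub>C\<^esub> g)"

definition plus_Id :: "('o, 'a) category \<Rightarrow> ('o, 'a) coproducts \<Rightarrow> ('o, 'a, 'm) endo_scheme
    \<Rightarrow> ('o, 'a) endo" where
  "plus_Id C P F =
     \<lparr>omap = (\<lambda>X. csum P (omap F X) X), amap = (\<lambda>f. sum_map C P (amap F f) f)\<rparr>"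


section \<open>Kleisli category\<close>

text \<open>An arrow \<open>X \<multimap> Y\<close> is a triple \<open>(X, f, Y)\<close> with \<open>f : X \<rightarrow> T Y\<close>: the object
  part of \<open>T\<close> need not be injective, so \<open>f\<close> alone does not determine the codomain \<open>Y\<close>.\<close>

definition Kl :: "('o, 'a) category \<Rightarrow> ('o, 'a) monad \<Rightarrow> ('o, 'o \<times> 'a \<times> 'o) category" where
  "Kl C T =
     \<lparr>Ob = Ob C,
      Ar = {(X, f, Y). X \<in> Ob C \<and> Y \<in> Ob C \<and> f \<in> hom C X (omap T Y)},
      Dom = (\<lambda>(X, f, Y). X),
      Cod = (\<lambda>(X, f, Y). Y),
      Idt = (\<lambda>X. (X, munit T X, X)),
      Comp = (\<lambda>(Y', g, Z) (X, f, Y). (X, mult T Z \<cdot>\<^bsub>C\<^esub> amap T g \<cdot>\<^bsub>C\<^esub> f, Z))\<rparr>"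

definition underlying :: "'o \<times> 'a \<times> 'o \<Rightarrow> 'a" where
  "underlying = (\<lambda>(X, f, Y). f)"

definition sharp :: "('o, 'a) category \<Rightarrow> ('o, 'a) monad \<Rightarrow> 'a \<Rightarrow> 'o \<times> 'a \<times> 'o" where
  "sharp C T f = (Dom C f, munit T (Cod C f) \<cdot>\<^bsub>C\<^esub> f, Cod C f)"

definition Kl_coproducts :: "('o, 'a) category \<Rightarrow> ('o, 'a) monad \<Rightarrow> ('o, 'a) coproducts
    \<Rightarrow> ('o, 'o \<times> 'a \<times> 'o) coproducts" where
  "Kl_coproducts C T P =
     \<lparr>csum = csum P,
      inj1 = (\<lambda>X Y. sharp C T (inj1 P X Y)),
      inj2 = (\<lambda>X Y. sharp C T (inj2 P X Y))\<rparr>"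

definition lifts :: "('o, 'a) category \<Rightarrow> ('o, 'a) monad \<Rightarrow> ('o, 'a, 'm) endo_scheme
    \<Rightarrow> ('o, 'o \<times> 'a \<times> 'o, 'n) endo_scheme \<Rightarrow> bool" where
  "lifts C T S S' \<longleftrightarrow>
     endofunctor (Kl C T) S' \<and>
     (\<forall>X\<in>Ob C. omap S' X = omap S X) \<and>
     (\<forall>f\<in>Ar C. amap S' (sharp C T f) = sharp C T (amap S f))"

context monad begin

lemma hom_Ob: "f \<in> hom C X Y \<Longrightarrow> X \<in> Ob C \<and> Y \<in> Ob C"
  using Dom_Ob Cod_Ob by (auto simp: hom_def)

lemma munit_hom: "X \<in> Ob C \<Longrightarrow> munit T X \<in> hom C X (omap T X)"
  using munit_natural by (auto simp: natural_def)
lemma mult_hom: "X \<in> Ob C \<Longrightarrow> mult T X \<in> hom C (omap T (omap T X)) (omap T X)"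
  using mult_natural by (auto simp: natural_def comp_endo_def)
lemma munit_nat: "f \<in> hom C X Y \<Longrightarrow> munit T Y \<cdot> f = amap T f \<cdot> munit T X"
  using munit_natural by (auto simp: natural_def)
lemma mult_nat: "f \<in> hom C X Y \<Longrightarrow> mult T Y \<cdot> amap T (amap T f) = amap T f \<cdot> mult T X"
  using mult_natural by (auto simp: natural_def comp_endo_def)

lemma Kl_hom: "\<phi> \<in> hom (Kl C T) X Y \<longleftrightarrow>
    X \<in> Ob C \<and> Y \<in> Ob C \<and> (\<exists>f\<in>hom C X (omap T Y). \<phi> = (X, f, Y))"
  by (auto simp: hom_def Kl_def)

lemma Kl_sel:
  "Ob (Kl C T) = Ob C" "Idt (Kl C T) X = (X, munit T X, X)" "Dom (Kl C T) (X,f,Y) = X" "Cod (Kl C T) (X,f,Y) = Y"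
  "(Y', g, Z) \<cdot>\<^bsub>Kl C T\<^esub> (X, f, Y) = (X, mult T Z \<cdot> amap T g \<cdot> f, Z)"
  by (auto simp: Kl_def)

lemma kleisli_ext:
  assumes f: "f \<in> hom C X (omap T Y)" and g: "g \<in> hom C Y (omap T Z)" and "Z \<in> Ob C"
  shows "mult T Z \<cdot> amap T g \<cdot> f \<in> hom C X (omap T Z)"
  using assms by (meson Comp_hom amap_hom mult_hom)

lemma sharp_comp_right:
  assumes f: "f \<in> hom C X Y" and g: "g \<in> hom C Y (omap T Z)" and Z: "Z \<in> Ob C"
  shows "(Y, g, Z) \<cdot>\<^bsub>Kl C T\<^esub> sharp C T f = (X, g \<cdot> f, Z)"
proof -
  have Y: "Y \<in> Ob C" using hom_Ob f by blast
  have tz: "omap T Z \<in> Ob C" using Z omap_Ob by blast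
  have "mult T Z \<cdot> amap T g \<cdot> munit T Y \<cdot> f = mult T Z \<cdot> (amap T g \<cdot> munit T Y) \<cdot> f"
    using Comp_assoc[OF f munit_hom[OF Y] amap_hom[OF g]] by simp
  also have "\<dots> = mult T Z \<cdot> (munit T (omap T Z) \<cdot> g) \<cdot> f" using munit_nat[OF g] by simp
  also have "\<dots> = mult T Z \<cdot> munit T (omap T Z) \<cdot> g \<cdot> f"
    using Comp_assoc[OF f g munit_hom[OF tz]] by simp
  also have "\<dots> = (mult T Z \<cdot> munit T (omap T Z)) \<cdot> g \<cdot> f"
    using Comp_assoc[OF Comp_hom[OF f g] munit_hom[OF tz] mult_hom[OF Z]] by simp
  also have "\<dots> = g \<cdot> f" using munit_left[OF Z] Idt_left[OF Comp_hom[OF f g]] by simp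
  finally show ?thesis using f by (auto simp: sharp_def Kl_def hom_def)
qed

lemma Kl_category: "category (Kl C T)"
proof
  fix W X Y Z \<phi> \<psi> \<chi>
  assume a: "\<phi> \<in> hom (Kl C T) W X" "\<psi> \<in> hom (Kl C T) X Y" "\<chi> \<in> hom (Kl C T) Y Z"
  then obtain f g h where f: "f \<in> hom C W (omap T X)" "\<phi> = (W,f,X)"
    and g: "g \<in> hom C X (omap T Y)" "\<psi> = (X,g,Y)"
    and h: "h \<in> hom C Y (omap T Z)" "\<chi> = (Y,h,Z)"
    and ob: "X \<in> Ob C" "Y \<in> Ob C" "Z \<in> Ob C" by (auto simp: Kl_hom)
  note m = mult_hom[OF ob(3)] mult_hom[OF ob(2)]
  have tg: "amap T g \<cdot> f \<in> hom C W (omap T (omap T Y))" using f g by (meson Comp_hom amap_hom)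
  have hh: "amap T h \<in> hom C (omap T Y) (omap T (omap T Z))" using h amap_hom by blast
  have hhh: "amap T (amap T h) \<in> hom C (omap T (omap T Y)) (omap T (omap T (omap T Z)))" using hh amap_hom by blast
  have tm: "amap T (mult T Z) \<in> hom C (omap T (omap T (omap T Z))) (omap T (omap T Z))" using m amap_hom by blast
  have tz: "omap T Z \<in> Ob C" using ob omap_Ob by blast
  have hg: "amap T h \<cdot> g \<in> hom C X (omap T (omap T Z))" using hh g Comp_hom by blast
  have "mult T Z \<cdot> amap T (mult T Z \<cdot> amap T h \<cdot> g) \<cdot> f
      = mult T Z \<cdot> (amap T (mult T Z) \<cdot> amap T (amap T h) \<cdot> amap T g) \<cdot> f"
    using amap_Comp[OF hg m(1)] amap_Comp[OF g(1) hh] by simp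
  also have "\<dots> = mult T Z \<cdot> amap T (mult T Z) \<cdot> amap T (amap T h) \<cdot> amap T g \<cdot> f"
    by (simp add: Comp_assoc[OF f(1) Comp_hom[OF amap_hom[OF g(1)] hhh] tm] Comp_assoc[OF f(1) amap_hom[OF g(1)] hhh])
  also have "\<dots> = mult T Z \<cdot> mult T (omap T Z) \<cdot> amap T (amap T h) \<cdot> amap T g \<cdot> f"
    using Comp_assoc[OF Comp_hom[OF tg hhh] tm m(1)] Comp_assoc[OF Comp_hom[OF tg hhh] mult_hom[OF tz] m(1)]
      mult_assoc[OF ob(3)] by simp
  also have "\<dots> = mult T Z \<cdot> amap T h \<cdot> mult T Y \<cdot> amap T g \<cdot> f"
    using Comp_assoc[OF tg hhh mult_hom[OF tz]] Comp_assoc[OF tg m(2) hh] mult_nat[OF h(1)] by simp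
  finally show "(\<chi> \<cdot>\<^bsub>Kl C T\<^esub> \<psi>) \<cdot>\<^bsub>Kl C T\<^esub> \<phi> = \<chi> \<cdot>\<^bsub>Kl C T\<^esub> (\<psi> \<cdot>\<^bsub>Kl C T\<^esub> \<phi>)"
    by (simp add: f g h Kl_sel)
next
  fix X Y \<phi> assume "\<phi> \<in> hom (Kl C T) X Y"
  then obtain f where f: "f \<in> hom C X (omap T Y)" "\<phi> = (X,f,Y)"
    and ob: "X \<in> Ob C" "Y \<in> Ob C" by (auto simp: Kl_hom)
  have "sharp C T (Idt C X) = (X, munit T X, X)"
    using Idt_right[OF munit_hom[OF ob(1)]] Idt_hom[OF ob(1)] by (auto simp: sharp_def hom_def)
  then show "\<phi> \<cdot>\<^bsub>Kl C T\<^esub> Idt (Kl C T) X = \<phi>"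
    using sharp_comp_right[OF Idt_hom[OF ob(1)] f(1) ob(2)] Idt_right[OF f(1)] f(2) by (simp add: Kl_sel)
  have "mult T Y \<cdot> amap T (munit T Y) \<cdot> f = f"
    using Comp_assoc[OF f(1) amap_hom[OF munit_hom[OF ob(2)]] mult_hom[OF ob(2)]]
      munit_right[OF ob(2)] Idt_left[OF f(1)] by simp
  then show "Idt (Kl C T) Y \<cdot>\<^bsub>Kl C T\<^esub> \<phi> = \<phi>" by (simp add: f Kl_sel)
next
  fix X Y Z f g assume "f \<in> hom (Kl C T) X Y" "g \<in> hom (Kl C T) Y Z"
  then show "g \<cdot>\<^bsub>Kl C T\<^esub> f \<in> hom (Kl C T) X Z"
    using kleisli_ext by (auto simp: Kl_hom Kl_sel)
qed (auto simp: Kl_hom Kl_sel munit_hom, auto simp: Kl_def)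

lemma Kl_binary_coproducts:
  assumes "binary_coproducts C P"
  shows "binary_coproducts (Kl C T) (Kl_coproducts C T P)"
proof -
  interpret P: binary_coproducts C P by fact
  interpret K: category "Kl C T" by (rule Kl_category)
  have sh: "sharp C T f \<in> hom (Kl C T) X Y" if "f \<in> hom C X Y" for f X Y
  proof -
    have "Y \<in> Ob C" "X \<in> Ob C" using hom_Ob that by blast+
    with Comp_hom[OF that munit_hom[of Y]] that show ?thesis by (auto simp: Kl_def sharp_def hom_def)
  qed
  show ?thesis
  proof
    fix \<phi> \<psi> X Y Z assume "\<phi> \<in> hom (Kl C T) X Z" "\<psi> \<in> hom (Kl C T) Y Z"
    then obtain f g where f: "f \<in> hom C X (omap T Z)" "\<phi> = (X,f,Z)" and g: "g \<in> hom C Y (omap T Z)" "\<psi> = (Y,g,Z)"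
      and ob: "X \<in> Ob C" "Y \<in> Ob C" "Z \<in> Ob C" by (auto simp: Kl_hom)
    note u = P.csum_universal[OF f(1) g(1)]
    have e: "(\<eta> \<in> hom (Kl C T) (csum P X Y) Z \<and> \<eta> \<cdot>\<^bsub>Kl C T\<^esub> sharp C T (inj1 P X Y) = \<phi> \<and> \<eta> \<cdot>\<^bsub>Kl C T\<^esub> sharp C T (inj2 P X Y) = \<psi>)
       \<longleftrightarrow> (\<exists>h. \<eta> = (csum P X Y, h, Z) \<and> h \<in> hom C (csum P X Y) (omap T Z) \<and> h \<cdot> inj1 P X Y = f \<and> h \<cdot> inj2 P X Y = g)" for \<eta>
      using sharp_comp_right[OF P.inj1_hom[OF ob(1,2)] _ ob(3)] sharp_comp_right[OF P.inj2_hom[OF ob(1,2)] _ ob(3)]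
        f g ob P.csum_Ob[OF ob(1,2)] by (auto simp: Kl_hom)
    show "\<exists>!h. h \<in> hom (Kl C T) (csum (Kl_coproducts C T P) X Y) Z \<and>
            h \<cdot>\<^bsub>Kl C T\<^esub> inj1 (Kl_coproducts C T P) X Y = \<phi> \<and> h \<cdot>\<^bsub>Kl C T\<^esub> inj2 (Kl_coproducts C T P) X Y = \<psi>"
      using u by (simp add: Kl_coproducts_def e) blast
  qed (auto simp: Kl_coproducts_def Kl_sel P.csum_Ob intro!: sh P.inj1_hom P.inj2_hom)
qed
end


section \<open>Order enrichment, zero morphisms and saturation\<close>

locale order_enriched = category K
  for K :: "('o, 'k) category" (structure) +
  fixes le :: "'k \<Rightarrow> 'k \<Rightarrow> bool"
  assumes le_refl: "f \<in> hom K X Y \<Longrightarrow> le f f"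
    and le_antisym: "f \<in> hom K X Y \<Longrightarrow> g \<in> hom K X Y \<Longrightarrow> le f g \<Longrightarrow> le g f \<Longrightarrow> f = g"
    and le_trans: "f \<in> hom K X Y \<Longrightarrow> g \<in> hom K X Y \<Longrightarrow> h \<in> hom K X Y
      \<Longrightarrow> le f g \<Longrightarrow> le g h \<Longrightarrow> le f h"
    and Comp_mono: "f \<in> hom K X Y \<Longrightarrow> f' \<in> hom K X Y \<Longrightarrow> g \<in> hom K Y Z \<Longrightarrow> g' \<in> hom K Y Z
      \<Longrightarrow> le f f' \<Longrightarrow> le g g' \<Longrightarrow> le (g \<cdot> f) (g' \<cdot> f')"

locale zero_morphisms = category K
  for K :: "('o, 'k) category" (structure) +
  fixes zero :: "'o \<Rightarrow> 'o \<Rightarrow> 'k"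
  assumes zero_hom: "X \<in> Ob K \<Longrightarrow> Y \<in> Ob K \<Longrightarrow> zero X Y \<in> hom K X Y"
    and Comp_zero: "X \<in> Ob K \<Longrightarrow> f \<in> hom K Y Z \<Longrightarrow> f \<cdot> zero X Y = zero X Z"
    and zero_Comp: "Z \<in> Ob K \<Longrightarrow> g \<in> hom K X Y \<Longrightarrow> zero Y Z \<cdot> g = zero X Z"

locale order_saturation_monad =
  monad C T + Kl: order_enriched "Kl C T" le
  for C :: "('o, 'a) category" (structure) and T :: "('o, 'a) monad"
    and le :: "'o \<times> 'a \<times> 'o \<Rightarrow> 'o \<times> 'a \<times> 'o \<Rightarrow> bool" +
  fixes star :: "'o \<times> 'a \<times> 'o \<Rightarrow> 'o \<times> 'a \<times> 'o"
  assumes star_hom: "\<alpha> \<in> hom (Kl C T) X X \<Longrightarrow> star \<alpha> \<in> hom (Kl C T) X X"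
    and star_refl: "\<alpha> \<in> hom (Kl C T) X X \<Longrightarrow> le (Idt (Kl C T) X) (star \<alpha>)"
    and star_incl: "\<alpha> \<in> hom (Kl C T) X X \<Longrightarrow> le \<alpha> (star \<alpha>)"
    and star_trans: "\<alpha> \<in> hom (Kl C T) X X \<Longrightarrow> le (star \<alpha> \<cdot>\<^bsub>Kl C T\<^esub> star \<alpha>) (star \<alpha>)"
    and star_least: "\<alpha> \<in> hom (Kl C T) X X \<Longrightarrow> \<beta> \<in> hom (Kl C T) X X
      \<Longrightarrow> le (Idt (Kl C T) X) \<beta> \<Longrightarrow> le \<alpha> \<beta> \<Longrightarrow> le (\<beta> \<cdot>\<^bsub>Kl C T\<^esub> \<beta>) \<beta> \<Longrightarrow> le (star \<alpha>) \<beta>"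
    and star_le: "f \<in> hom C X Y \<Longrightarrow> \<alpha> \<in> hom (Kl C T) X X \<Longrightarrow> \<beta> \<in> hom (Kl C T) Y Y
      \<Longrightarrow> le (sharp C T f \<cdot>\<^bsub>Kl C T\<^esub> \<alpha>) (\<beta> \<cdot>\<^bsub>Kl C T\<^esub> sharp C T f)
      \<Longrightarrow> le (sharp C T f \<cdot>\<^bsub>Kl C T\<^esub> star \<alpha>) (star \<beta> \<cdot>\<^bsub>Kl C T\<^esub> sharp C T f)"
    and star_ge: "f \<in> hom C X Y \<Longrightarrow> \<alpha> \<in> hom (Kl C T) X X \<Longrightarrow> \<beta> \<in> hom (Kl C T) Y Y
      \<Longrightarrow> le (\<beta> \<cdot>\<^bsub>Kl C T\<^esub> sharp C T f) (sharp C T f \<cdot>\<^bsub>Kl C T\<^esub> \<alpha>)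
      \<Longrightarrow> le (star \<beta> \<cdot>\<^bsub>Kl C T\<^esub> sharp C T f) (sharp C T f \<cdot>\<^bsub>Kl C T\<^esub> star \<alpha>)"

definition locally_monotonic :: "('o, 'k) category \<Rightarrow> ('k \<Rightarrow> 'k \<Rightarrow> bool) \<Rightarrow> ('o, 'k, 'm) endo_scheme
    \<Rightarrow> bool" where
  "locally_monotonic K le S \<longleftrightarrow>
     (\<forall>X Y f g. f \<in> hom K X Y \<longrightarrow> g \<in> hom K X Y \<longrightarrow> le f g \<longrightarrow> le (amap S f) (amap S g))"

text \<open>For a monad \<open>S\<close> on \<open>K\<close> and \<open>\<alpha> : X \<rightarrow> S X\<close> this is \<open>(m\<^sub>X \<cdot> S \<alpha>)\<^sup>* \<cdot> e\<^sub>X\<close>.\<close>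

definition saturate :: "('o, 'k) category \<Rightarrow> ('k \<Rightarrow> 'k) \<Rightarrow> ('o, 'k) monad \<Rightarrow> 'k \<Rightarrow> 'k" where
  "saturate K star S \<alpha> =
     star (mult S (Dom K \<alpha>) \<cdot>\<^bsub>K\<^esub> amap S \<alpha>) \<cdot>\<^bsub>K\<^esub> munit S (Dom K \<alpha>)"

definition saturation_compatible :: "('o, 'k) category \<Rightarrow> ('k \<Rightarrow> 'k) \<Rightarrow> ('o, 'k) monad \<Rightarrow> bool" where
  "saturation_compatible K star S \<longleftrightarrow>
     (\<forall>X\<in>Ob K. \<forall>\<alpha>\<in>hom K X (omap S X).
        mult S X \<cdot>\<^bsub>K\<^esub> amap S (star (mult S X \<cdot>\<^bsub>K\<^esub> amap S \<alpha>) \<cdot>\<^bsub>K\<^esub> munit S X)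
        = star (mult S X \<cdot>\<^bsub>K\<^esub> amap S \<alpha>))"


section \<open>Free algebras and free monads\<close>

text \<open>\<open>fobj A X\<close> with \<open>funit A X : X \<rightarrow> fobj A X\<close> and
  \<open>fstr A X : F (fobj A X) \<rightarrow> fobj A X\<close> is the free \<open>F\<close>-algebra over \<open>X\<close>.\<close>

record ('o, 'a) free_algs =
  fobj :: "'o \<Rightarrow> 'o"
  funit :: "'o \<Rightarrow> 'a"
  fstr :: "'o \<Rightarrow> 'a"

locale free_algebras = endofunctor C F
  for C :: "('o, 'a) category" (structure) and F :: "('o, 'a) endo" +
  fixes A :: "('o, 'a) free_algs"
  assumes fobj_Ob: "X \<in> Ob C \<Longrightarrow> fobj A X \<in> Ob C"
    and funit_hom: "X \<in> Ob C \<Longrightarrow> funit A X \<in> hom C X (fobj A X)"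
    and fstr_hom: "X \<in> Ob C \<Longrightarrow> fstr A X \<in> hom C (omap F (fobj A X)) (fobj A X)"
    and free_universal: "f \<in> hom C X B \<Longrightarrow> b \<in> hom C (omap F B) B
      \<Longrightarrow> \<exists>!k. k \<in> hom C (fobj A X) B \<and> k \<cdot> funit A X = f \<and> k \<cdot> fstr A X = b \<cdot> amap F k"

definition free_extension :: "('o, 'a) category \<Rightarrow> ('o, 'a) endo \<Rightarrow> ('o, 'a) free_algs
    \<Rightarrow> 'a \<Rightarrow> 'a \<Rightarrow> 'a" where
  "free_extension C F A f b =
     (THE k. k \<in> hom C (fobj A (Dom C f)) (Cod C f) \<and>
             k \<cdot>\<^bsub>C\<^esub> funit A (Dom C f) = f \<and>
             k \<cdot>\<^bsub>C\<^esub> fstr A (Dom C f) = b \<cdot>\<^bsub>C\<^esub> amap F k)"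

definition free_monad :: "('o, 'a) category \<Rightarrow> ('o, 'a) endo \<Rightarrow> ('o, 'a) free_algs
    \<Rightarrow> ('o, 'a) monad" where
  "free_monad C F A =
     \<lparr>omap = fobj A,
      amap = (\<lambda>f. free_extension C F A (funit A (Cod C f) \<cdot>\<^bsub>C\<^esub> f) (fstr A (Cod C f))),
      mult = (\<lambda>X. free_extension C F A (Idt C (fobj A X)) (fstr A X)),
      munit = funit A\<rparr>"

locale free_monad_over = endofunctor C F + M: monad C M
  for C :: "('o, 'a) category" (structure) and F :: "('o, 'a) endo" and M :: "('o, 'a) monad" +
  fixes \<nu> :: "'o \<Rightarrow> 'a"
  assumes nu_natural: "natural C F M \<nu>"
    and nu_universal: "monad C N \<Longrightarrow> natural C F N \<sigma> \<Longrightarrow>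
      \<exists>\<tau>. monad_morphism C M N \<tau> \<and> (\<forall>X\<in>Ob C. \<tau> X \<cdot> \<nu> X = \<sigma> X) \<and>
          (\<forall>\<tau>'. monad_morphism C M N \<tau>' \<and> (\<forall>X\<in>Ob C. \<tau>' X \<cdot> \<nu> X = \<sigma> X)
                 \<longrightarrow> (\<forall>X\<in>Ob C. \<tau>' X = \<tau> X))"


section \<open>Setting\<close>

text \<open>The monad \<open>F + Id\<close> with unit \<open>\<iota>\<^sup>2\<close> and multiplication
  \<open>[\<iota>\<^sup>1, id] \<cdot> (F [0, id] + id)\<close>.\<close>

definition tau_monad :: "('o, 'k) category \<Rightarrow> ('o, 'k) coproducts \<Rightarrow> ('o \<Rightarrow> 'o \<Rightarrow> 'k)
    \<Rightarrow> ('o, 'k) endo \<Rightarrow> ('o, 'k) monad" where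
  "tau_monad K P zero F =
     \<lparr>omap = omap (plus_Id K P F),
      amap = amap (plus_Id K P F),
      mult = (\<lambda>X. let FX = omap F X; S = csum P FX X in
                cotuple K P (inj1 P FX X) (Idt K S) \<cdot>\<^bsub>K\<^esub>
                sum_map K P (amap F (cotuple K P (zero FX X) (Idt K X))) (Idt K S)),
      munit = (\<lambda>X. inj2 P (omap F X) X)\<rparr>"

locale weak_bisimulation_setting =
  order_saturation_monad C T le star +
  binary_coproducts C P +
  Kl: zero_morphisms "Kl C T" zero +
  free_algebras C F A +
  Kl: free_monad_over "Kl C T" F' Fst' \<nu>
  for C :: "('o, 'a) category" (structure)
    and T :: "('o, 'a) monad"
    and le :: "'o \<times> 'a \<times> 'o \<Rightarrow> 'o \<times> 'a \<times> 'o \<Rightarrow> bool"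
    and star :: "'o \<times> 'a \<times> 'o \<Rightarrow> 'o \<times> 'a \<times> 'o"
    and P :: "('o, 'a) coproducts"
    and zero :: "'o \<Rightarrow> 'o \<Rightarrow> 'o \<times> 'a \<times> 'o"
    and F :: "('o, 'a) endo"
    and A :: "('o, 'a) free_algs"
    and F' :: "('o, 'o \<times> 'a \<times> 'o) endo"
    and Fst' :: "('o, 'o \<times> 'a \<times> 'o) monad"
    and \<nu> :: "'o \<Rightarrow> 'o \<times> 'a \<times> 'o" +
  assumes F_lifts: "lifts C T F F'"
    and Ftau_monad: "monad (Kl C T) (tau_monad (Kl C T) (Kl_coproducts C T P) zero F')"
    and Ftau_monotonic:
      "locally_monotonic (Kl C T) le (tau_monad (Kl C T) (Kl_coproducts C T P) zero F')"
    and Ftau_compatible: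
      "saturation_compatible (Kl C T) star (tau_monad (Kl C T) (Kl_coproducts C T P) zero F')"
    and Fst_lifts: "lifts C T (free_monad C F A) Fst'"
    and Fst_monotonic: "locally_monotonic (Kl C T) le Fst'"
    and Fst_compatible: "saturation_compatible (Kl C T) star Fst'"

text \<open>The arrow \<open>[\<nu>\<^sub>X, e\<^sub>X]\<close>.\<close>

definition nu_e :: "('o, 'k) category \<Rightarrow> ('o, 'k) coproducts \<Rightarrow> ('o, 'k) monad \<Rightarrow> ('o \<Rightarrow> 'k)
    \<Rightarrow> 'o \<Rightarrow> 'k" where
  "nu_e K P M \<nu> X = cotuple K P (\<nu> X) (munit M X)"


section \<open>Kernel bisimulations\<close>

definition coalgebra :: "('o, 'a) category \<Rightarrow> ('o, 'a, 'm) endo_scheme \<Rightarrow> 'o \<Rightarrow> 'a \<Rightarrow> bool" where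
  "coalgebra C G X \<alpha> \<longleftrightarrow> X \<in> Ob C \<and> \<alpha> \<in> hom C X (omap G X)"

definition coalgebra_hom :: "('o, 'a) category \<Rightarrow> ('o, 'a, 'm) endo_scheme
    \<Rightarrow> 'o \<Rightarrow> 'a \<Rightarrow> 'o \<Rightarrow> 'a \<Rightarrow> 'a \<Rightarrow> bool" where
  "coalgebra_hom C G X \<alpha> Y \<beta> f \<longleftrightarrow> f \<in> hom C X Y \<and> amap G f \<cdot>\<^bsub>C\<^esub> \<alpha> = \<beta> \<cdot>\<^bsub>C\<^esub> f"

definition jointly_monic :: "('o, 'a) category \<Rightarrow> 'o \<Rightarrow> 'a \<Rightarrow> 'a \<Rightarrow> bool" where
  "jointly_monic C R p q \<longleftrightarrow>
     (\<forall>W u v. u \<in> hom C W R \<longrightarrow> v \<in> hom C W R \<longrightarrow>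
        p \<cdot>\<^bsub>C\<^esub> u = p \<cdot>\<^bsub>C\<^esub> v \<longrightarrow> q \<cdot>\<^bsub>C\<^esub> u = q \<cdot>\<^bsub>C\<^esub> v \<longrightarrow> u = v)"

definition pullback :: "('o, 'a) category \<Rightarrow> 'a \<Rightarrow> 'a \<Rightarrow> 'o \<Rightarrow> 'a \<Rightarrow> 'a \<Rightarrow> bool" where
  "pullback C f g R p q \<longleftrightarrow>
     R \<in> Ob C \<and> p \<in> hom C R (Dom C f) \<and> q \<in> hom C R (Dom C g) \<and>
     f \<cdot>\<^bsub>C\<^esub> p = g \<cdot>\<^bsub>C\<^esub> q \<and>
     (\<forall>W u v. u \<in> hom C W (Dom C f) \<longrightarrow> v \<in> hom C W (Dom C g) \<longrightarrow> f \<cdot>\<^bsub>C\<^esub> u = g \<cdot>\<^bsub>C\<^esub> v \<longrightarrow>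
        (\<exists>!w. w \<in> hom C W R \<and> p \<cdot>\<^bsub>C\<^esub> w = u \<and> q \<cdot>\<^bsub>C\<^esub> w = v))"

definition bisimulation :: "('o, 'a) category \<Rightarrow> ('o, 'a, 'm) endo_scheme
    \<Rightarrow> 'o \<Rightarrow> 'a \<Rightarrow> 'o \<Rightarrow> 'a \<Rightarrow> 'o \<Rightarrow> 'a \<Rightarrow> 'a \<Rightarrow> bool" where
  "bisimulation C G X \<alpha> Y \<beta> R p q \<longleftrightarrow>
     coalgebra C G X \<alpha> \<and> coalgebra C G Y \<beta> \<and>
     R \<in> Ob C \<and> p \<in> hom C R X \<and> q \<in> hom C R Y \<and> jointly_monic C R p q \<and>
     (\<exists>Z \<gamma> f g. coalgebra C G Z \<gamma> \<and>
        coalgebra_hom C G X \<alpha> Z \<gamma> f \<and> coalgebra_hom C G Y \<beta> Z \<gamma> g \<and> pullback C f g R p q)"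

abbreviation bisimulation_on :: "('o, 'a) category \<Rightarrow> ('o, 'a, 'm) endo_scheme
    \<Rightarrow> 'o \<Rightarrow> 'a \<Rightarrow> 'o \<Rightarrow> 'a \<Rightarrow> 'a \<Rightarrow> bool" where
  "bisimulation_on C G X \<alpha> R p q \<equiv> bisimulation C G X \<alpha> X \<alpha> R p q"

end

theory Submission
  imports Defs
begin

text \<open>
  Write \<open>n = [\<nu>\<^sub>X, e\<^sub>X]\<close>. If condition (e) applies to \<open>n\<close>, the hypothesis on \<open>\<alpha>\<close> gives
  \<open>n \<cdot> (m' \<cdot> F\<^sub>\<tau> \<alpha>)\<^sup>* \<le> (m \<cdot> F\<^sup>* (n \<cdot> \<alpha>))\<^sup>* \<cdot> n\<close>; with idempotence and monotonicity of saturation,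
  \<open>n \<cdot> \<alpha>\<close> and \<open>n \<cdot> \<alpha>\<^sup>\<star>\<close> then have the same saturation. Since \<open>n\<close> is natural and saturation preserves
  homomorphisms, a cospan from \<open>\<alpha>\<^sup>\<star>\<close> into \<open>\<gamma>\<close> is also one into the saturation of \<open>[\<nu>, e] \<cdot> \<gamma>\<close>, with the
  same pullback.

  Condition (e) concerns only arrows \<open>k\<^sup>\<sharp>\<close>, and \<open>\<nu>\<^sub>X\<close>, \<open>e\<^sub>X\<close> need not be of this form: only the functor
  part of the free monad on the Kleisli category is assumed to be a lifting. But free \<open>F\<close>-algebras of
  the base category remain free in the Kleisli category, so by uniqueness of free monads
  \<open>n = s \<cdot> k\<^sup>\<sharp>\<close> with \<open>s\<close> invertible, and (e) extends to such arrows.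
\<close>

section \<open>The laws of categories, functors and monads in terms of \<open>Ar\<close>,
  \<open>Dom\<close> and \<open>Cod\<close>\<close>

context category
begin

lemma homD:
  assumes "f \<in> hom C X Y"
  shows "f \<in> Ar C" "Dom C f = X" "Cod C f = Y" "X \<in> Ob C" "Y \<in> Ob C"
  using assms Dom_Ob Cod_Ob by (auto simp: hom_def)

text \<open>A premise \<open>f \<in> hom C X Y\<close> leaves objects for the simplifier to guess,
  whereas equations between \<open>Dom\<close> and \<open>Cod\<close> are discharged by rewriting.
  Hence this and the following restatements of the laws.\<close>

lemma Comp_arr [simp]:
  assumes "f \<in> Ar C" "g \<in> Ar C" "Dom C g = Cod C f"
  shows "g \<cdot> f \<in> Ar C" "Dom C (g \<cdot> f) = Dom C f" "Cod C (g \<cdot> f) = Cod C g"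
  using Comp_hom[of f "Dom C f" "Cod C f" g "Cod C g"] assms by (auto simp: hom_def)

lemma Comp_assoc_arr [simp]:
  assumes "f \<in> Ar C" "g \<in> Ar C" "h \<in> Ar C" "Dom C g = Cod C f" "Dom C h = Cod C g"
  shows "(h \<cdot> g) \<cdot> f = h \<cdot> (g \<cdot> f)"
  using Comp_assoc[of f "Dom C f" "Cod C f" g "Cod C g" h "Cod C h"] assms by (auto simp: hom_def)

lemma Idt_arr [simp]:
  assumes "X \<in> Ob C"
  shows "Idt C X \<in> Ar C" "Dom C (Idt C X) = X" "Cod C (Idt C X) = X"
  using Idt_hom[OF assms] by (auto simp: hom_def)

lemma Idt_Comp_arr [simp]:
  assumes "f \<in> Ar C"
  shows "Cod C f = X \<Longrightarrow> Idt C X \<cdot> f = f" "Dom C f = X \<Longrightarrow> f \<cdot> Idt C X = f"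
  using Idt_left[of f "Dom C f" "Cod C f"] Idt_right[of f "Dom C f" "Cod C f"] assms
  by (auto simp: hom_def)

text \<open>Composition is normalised to the right, so \<open>g \<cdot> f\<close> is not a subterm
  of a longer chain; appending \<open>x\<close> to a known equation restores the match.\<close>

lemma Comp_eq_extend:
  assumes "g \<cdot> f = k" "f \<in> Ar C" "g \<in> Ar C" "Dom C g = Cod C f" "x \<in> Ar C" "Dom C f = Cod C x"
  shows "g \<cdot> f \<cdot> x = k \<cdot> x"
  using assms Comp_assoc_arr[of x f g] by auto

lemma Comp_eq_extend2:
  assumes "g \<cdot> f = k \<cdot> l" "f \<in> Ar C" "g \<in> Ar C" "Dom C g = Cod C f"
    "l \<in> Ar C" "k \<in> Ar C" "Dom C k = Cod C l" "x \<in> Ar C" "Dom C f = Cod C x" "Dom C l = Cod C x"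
  shows "g \<cdot> f \<cdot> x = k \<cdot> l \<cdot> x"
  using assms Comp_assoc_arr[of x f g] Comp_assoc_arr[of x l k] by auto

end

context endofunctor
begin

lemma amap_arr [simp]:
  assumes "f \<in> Ar C"
  shows "amap F f \<in> Ar C" "Dom C (amap F f) = omap F (Dom C f)" "Cod C (amap F f) = omap F (Cod C f)"
  using amap_hom[of f "Dom C f" "Cod C f"] assms by (auto simp: hom_def)

lemma amap_Comp_arr:
  assumes "f \<in> Ar C" "g \<in> Ar C" "Dom C g = Cod C f"
  shows "amap F (g \<cdot> f) = amap F g \<cdot> amap F f"
  using amap_Comp[of f "Dom C f" "Cod C f" g "Cod C g"] assms by (auto simp: hom_def)

declare omap_Ob [simp] amap_Idt [simp]

end

lemma naturalD:
  assumes "natural C F G \<sigma>"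
  shows "X \<in> Ob C \<Longrightarrow> \<sigma> X \<in> Ar C" "X \<in> Ob C \<Longrightarrow> Dom C (\<sigma> X) = omap F X"
    "X \<in> Ob C \<Longrightarrow> Cod C (\<sigma> X) = omap G X"
    "f \<in> Ar C \<Longrightarrow> \<sigma> (Cod C f) \<cdot>\<^bsub>C\<^esub> amap F f = amap G f \<cdot>\<^bsub>C\<^esub> \<sigma> (Dom C f)"
  using assms by (auto simp: natural_def hom_def)

context monad
begin

lemma munit_arr [simp]:
  assumes "X \<in> Ob C"
  shows "munit T X \<in> Ar C" "Dom C (munit T X) = X" "Cod C (munit T X) = omap T X"
  using munit_hom[OF assms] by (auto simp: hom_def)

lemma mult_arr [simp]:
  assumes "X \<in> Ob C"
  shows "mult T X \<in> Ar C" "Dom C (mult T X) = omap T (omap T X)" "Cod C (mult T X) = omap T X"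
  using mult_hom[OF assms] by (auto simp: hom_def)

lemma munit_nat_arr:
  "f \<in> Ar C \<Longrightarrow> munit T (Cod C f) \<cdot> f = amap T f \<cdot> munit T (Dom C f)"
  using munit_nat by (auto simp: hom_def)

lemma mult_nat_arr:
  "f \<in> Ar C \<Longrightarrow> mult T (Cod C f) \<cdot> amap T (amap T f) = amap T f \<cdot> mult T (Dom C f)"
  using mult_nat by (auto simp: hom_def)

end

section \<open>Free algebras and free monads\<close>

context free_algebras
begin

lemma free_arr [simp]:
  assumes "X \<in> Ob C"
  shows "funit A X \<in> Ar C" "Dom C (funit A X) = X" "Cod C (funit A X) = fobj A X"
    "fstr A X \<in> Ar C" "Dom C (fstr A X) = omap F (fobj A X)" "Cod C (fstr A X) = fobj A X"
  using funit_hom[OF assms] fstr_hom[OF assms] by (auto simp: hom_def)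

declare fobj_Ob [simp]

lemma free_extension:
  assumes f: "f \<in> hom C X B" and b: "b \<in> hom C (omap F B) B"
  shows "free_extension C F A f b \<in> hom C (fobj A X) B"
    and "free_extension C F A f b \<cdot> funit A X = f"
    and "free_extension C F A f b \<cdot> fstr A X = b \<cdot> amap F (free_extension C F A f b)"
proof -
  have "Dom C f = X" "Cod C f = B" using homD[OF f] by auto
  with theI'[OF free_universal[OF f b]]
  show "free_extension C F A f b \<in> hom C (fobj A X) B"
    "free_extension C F A f b \<cdot> funit A X = f"
    "free_extension C F A f b \<cdot> fstr A X = b \<cdot> amap F (free_extension C F A f b)"
    by (simp_all add: free_extension_def)
qed

lemma free_extension_arr:
  assumes "f \<in> Ar C" "Dom C f = X" "Cod C f = B" "b \<in> Ar C" "Dom C b = omap F B" "Cod C b = B"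
  shows "free_extension C F A f b \<in> Ar C" "Dom C (free_extension C F A f b) = fobj A X"
    "Cod C (free_extension C F A f b) = B" "free_extension C F A f b \<cdot> funit A X = f"
    "free_extension C F A f b \<cdot> fstr A X = b \<cdot> amap F (free_extension C F A f b)"
  using free_extension[of f X B b] assms by (auto simp: hom_def)

text \<open>The uniqueness half of \<open>free_universal\<close>, with
  \<open>h \<cdot> funit A X\<close> as the map to be extended. It reduces equations between arrows
  out of a free algebra to the generators.\<close>

lemma free_unique:
  assumes "X \<in> Ob C" "b \<in> Ar C" "Dom C b = omap F B" "Cod C b = B"
    and h: "h \<in> Ar C" "Dom C h = fobj A X" "Cod C h = B" "h \<cdot> fstr A X = b \<cdot> amap F h"
    and k: "k \<in> Ar C" "Dom C k = fobj A X" "Cod C k = B" "k \<cdot> fstr A X = b \<cdot> amap F k"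
    and eq: "h \<cdot> funit A X = k \<cdot> funit A X"
  shows "h = k"
proof -
  have "h \<cdot> funit A X \<in> hom C X B" "b \<in> hom C (omap F B) B"
    using assms by (auto simp: hom_def)
  from free_universal[OF this] show ?thesis
    using assms by (auto simp: hom_def)
qed

section \<open>The monad of free algebras\<close>

abbreviation "Fs \<equiv> free_monad C F A"

lemma Fs_sel [simp]: "omap Fs = fobj A" "munit Fs = funit A"
  by (auto simp: free_monad_def)

lemma Fs_amap:
  assumes "f \<in> Ar C"
  shows "amap Fs f \<in> Ar C" "Dom C (amap Fs f) = fobj A (Dom C f)"
    "Cod C (amap Fs f) = fobj A (Cod C f)"
    "amap Fs f \<cdot> funit A (Dom C f) = funit A (Cod C f) \<cdot> f"
    "amap Fs f \<cdot> fstr A (Dom C f) = fstr A (Cod C f) \<cdot> amap F (amap Fs f)"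
  using free_extension_arr[of "funit A (Cod C f) \<cdot> f" "Dom C f" "fobj A (Cod C f)" "fstr A (Cod C f)"]
    assms Dom_Ob[OF assms] Cod_Ob[OF assms]
  by (simp_all add: free_monad_def)

lemma Fs_mult:
  assumes "X \<in> Ob C"
  shows "mult Fs X \<in> Ar C" "Dom C (mult Fs X) = fobj A (fobj A X)"
    "Cod C (mult Fs X) = fobj A X"
    "mult Fs X \<cdot> funit A (fobj A X) = Idt C (fobj A X)"
    "mult Fs X \<cdot> fstr A (fobj A X) = fstr A X \<cdot> amap F (mult Fs X)"
  using free_extension_arr[of "Idt C (fobj A X)" "fobj A X" "fobj A X" "fstr A X"] assms
  by (simp_all add: free_monad_def)

text \<open>The two homomorphism squares are pasted, and functoriality of \<open>F\<close> merges
  the lifted arrows. This supplies the homomorphism premises of \<open>free_unique\<close>.\<close>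

lemma alg_hom_Comp:
  assumes h: "h \<in> Ar C" "Dom C h = fobj A X" "Cod C h = B" "h \<cdot> fstr A X = b \<cdot> amap F h"
    and k: "k \<in> Ar C" "Dom C k = B" "Cod C k = D" "k \<cdot> b = d \<cdot> amap F k"
    and b: "b \<in> Ar C" "Dom C b = omap F B" "Cod C b = B"
    and d: "d \<in> Ar C" "Dom C d = omap F D" "Cod C d = D"
    and X: "X \<in> Ob C"
  shows "(k \<cdot> h) \<cdot> fstr A X = d \<cdot> amap F (k \<cdot> h)"
proof -
  have "(k \<cdot> h) \<cdot> fstr A X = k \<cdot> b \<cdot> amap F h" using assms by simp
  also have "\<dots> = (d \<cdot> amap F k) \<cdot> amap F h" using Comp_eq_extend[OF k(4)] assms by simp
  also have "\<dots> = d \<cdot> amap F (k \<cdot> h)" using assms by (simp add: amap_Comp_arr)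
  finally show ?thesis .
qed

text \<open>Apart from the left unit law and naturality of the unit, which hold by construction,
  both sides of each law are algebra homomorphisms out of a free algebra, so it suffices to compare
  them on generators.\<close>

lemma free_monad_monad: "monad C Fs"
proof -
  note a = Fs_amap Fs_mult
  have id: "amap Fs (Idt C X) = Idt C (omap Fs X)" if "X \<in> Ob C" for X
    by (rule free_unique[where b = "fstr A X" and X = X and B = "fobj A X"])
      (use that Fs_amap[of "Idt C X"] in auto)
  have comp: "amap Fs (g \<cdot> f) = amap Fs g \<cdot> amap Fs f"
    if fg: "f \<in> Ar C" "g \<in> Ar C" "Dom C g = Cod C f" for f g
  proof (rule free_unique[where b = "fstr A (Cod C g)" and X = "Dom C f" and B = "fobj A (Cod C g)"])
    note o = Dom_Ob[OF fg(1)] Cod_Ob[OF fg(1)] Cod_Ob[OF fg(2)]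
    show "(amap Fs g \<cdot> amap Fs f) \<cdot> fstr A (Dom C f) = fstr A (Cod C g) \<cdot> amap F (amap Fs g \<cdot> amap Fs f)"
      by (rule alg_hom_Comp[where b = "fstr A (Cod C f)"]) (use fg o Fs_amap[of f] Fs_amap[of g] in auto)
    show "amap Fs (g \<cdot> f) \<cdot> funit A (Dom C f) = (amap Fs g \<cdot> amap Fs f) \<cdot> funit A (Dom C f)"
      using fg o Fs_amap[of f] Fs_amap[of g] Fs_amap[of "g \<cdot> f"]
        Comp_eq_extend2[of "amap Fs g" "funit A (Cod C f)" "funit A (Cod C g)" g f] by simp
  qed (use fg Fs_amap[of f] Fs_amap[of g] Fs_amap[of "g \<cdot> f"] Dom_Ob Cod_Ob in auto)
  have nat: "mult Fs Y \<cdot> amap Fs (amap Fs f) = amap Fs f \<cdot> mult Fs X"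
    if f: "f \<in> hom C X Y" for f X Y
  proof (rule free_unique[where b = "fstr A Y" and X = "fobj A X" and B = "fobj A Y"])
    note f' = homD[OF f]
    note b = Fs_amap[OF f'(1), unfolded f'(2,3)] Fs_mult[OF f'(4)] Fs_mult[OF f'(5)]
      Fs_amap[of "amap Fs f"]
    show "(mult Fs Y \<cdot> amap Fs (amap Fs f)) \<cdot> fstr A (fobj A X)
        = fstr A Y \<cdot> amap F (mult Fs Y \<cdot> amap Fs (amap Fs f))"
      by (rule alg_hom_Comp[where b = "fstr A (fobj A Y)"]) (use f' b in auto)
    show "(amap Fs f \<cdot> mult Fs X) \<cdot> fstr A (fobj A X) = fstr A Y \<cdot> amap F (amap Fs f \<cdot> mult Fs X)"
      by (rule alg_hom_Comp[where b = "fstr A X"]) (use f' b in auto)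
    show "(mult Fs Y \<cdot> amap Fs (amap Fs f)) \<cdot> funit A (fobj A X)
        = (amap Fs f \<cdot> mult Fs X) \<cdot> funit A (fobj A X)"
      using f' b Comp_eq_extend[of "mult Fs Y" "funit A (fobj A Y)" _ "amap Fs f"] by simp
  qed (use homD[OF f] a in auto)
  have assoc: "mult Fs X \<cdot> amap Fs (mult Fs X) = mult Fs X \<cdot> mult Fs (omap Fs X)"
    if X: "X \<in> Ob C" for X
  proof (rule free_unique[where b = "fstr A X" and X = "fobj A (fobj A X)" and B = "fobj A X"])
    note b = Fs_mult[OF X] Fs_mult[OF fobj_Ob[OF X]] Fs_amap[of "mult Fs X"]
    show "(mult Fs X \<cdot> amap Fs (mult Fs X)) \<cdot> fstr A (fobj A (fobj A X))
        = fstr A X \<cdot> amap F (mult Fs X \<cdot> amap Fs (mult Fs X))"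
      by (rule alg_hom_Comp[where b = "fstr A (fobj A X)"]) (use X b in auto)
    show "(mult Fs X \<cdot> mult Fs (omap Fs X)) \<cdot> fstr A (fobj A (fobj A X))
        = fstr A X \<cdot> amap F (mult Fs X \<cdot> mult Fs (omap Fs X))"
      by (rule alg_hom_Comp[where b = "fstr A (fobj A X)"]) (use X b in auto)
    show "(mult Fs X \<cdot> amap Fs (mult Fs X)) \<cdot> funit A (fobj A (fobj A X))
        = (mult Fs X \<cdot> mult Fs (omap Fs X)) \<cdot> funit A (fobj A (fobj A X))"
      using X b Comp_eq_extend[of "mult Fs X" "funit A (fobj A X)" _ "mult Fs X"] by simp
  qed (use X a in auto)
  have right: "mult Fs X \<cdot> amap Fs (munit Fs X) = Idt C (omap Fs X)" if X: "X \<in> Ob C" for X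
  proof (rule free_unique[where b = "fstr A X" and X = X and B = "fobj A X"])
    note b = Fs_mult[OF X] Fs_amap[of "funit A X"]
    show "(mult Fs X \<cdot> amap Fs (munit Fs X)) \<cdot> fstr A X
        = fstr A X \<cdot> amap F (mult Fs X \<cdot> amap Fs (munit Fs X))"
      by (rule alg_hom_Comp[where b = "fstr A (fobj A X)"]) (use X b in auto)
    show "(mult Fs X \<cdot> amap Fs (munit Fs X)) \<cdot> funit A X = Idt C (omap Fs X) \<cdot> funit A X"
      using X b Comp_eq_extend[of "mult Fs X" "funit A (fobj A X)" _ "funit A X"] by simp
  qed (use X a in auto)
  show ?thesis
  proof
    show "natural C (comp_endo Fs Fs) Fs (mult Fs)"
      using nat a by (auto simp: natural_def comp_endo_def hom_def)
    show "natural C \<lparr>omap = \<lambda>X. X, amap = \<lambda>f. f\<rparr> Fs (munit Fs)"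
      using a by (auto simp: natural_def hom_def)
  qed (use id comp assoc right a in \<open>auto simp: hom_def\<close>)
qed

section \<open>The monad morphism induced by a natural transformation out of
  \<open>F\<close>\<close>

definition free_nu :: "'o \<Rightarrow> 'a" where
  "free_nu X = fstr A X \<cdot> amap F (funit A X)"

text \<open>\<open>free_nu\<close> builds one layer of \<open>F\<close> over generators, and
  \<open>amap Fs f\<close> is an algebra homomorphism extending \<open>f\<close>, so it commutes
  with both ingredients.\<close>

lemma free_nu_natural: "natural C F Fs free_nu"
proof -
  have "free_nu Y \<cdot> amap F f = amap Fs f \<cdot> free_nu X" if f: "f \<in> hom C X Y" for f X Y
  proof -
    note f' = homD[OF f]
    note b = Fs_amap(1-5)[OF f'(1), unfolded f'(2,3)]
    have "amap Fs f \<cdot> free_nu X = fstr A Y \<cdot> amap F (amap Fs f) \<cdot> amap F (funit A X)"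
      unfolding free_nu_def using f' b by (simp add: Comp_eq_extend[OF b(5)])
    also have "\<dots> = fstr A Y \<cdot> amap F (funit A Y \<cdot> f)"
      using f' b by (simp flip: amap_Comp_arr)
    also have "\<dots> = free_nu Y \<cdot> amap F f"
      unfolding free_nu_def using f' by (simp add: amap_Comp_arr)
    finally show ?thesis by simp
  qed
  then show ?thesis by (auto simp: natural_def hom_def free_nu_def)
qed

lemma free_nu_arr [simp]:
  assumes "X \<in> Ob C"
  shows "free_nu X \<in> Ar C" "Dom C (free_nu X) = omap F X" "Cod C (free_nu X) = fobj A X"
  using assms by (auto simp: free_nu_def)

text \<open>The algebra structure is thus recovered from the monad and \<open>free_nu\<close>; a
  monad morphism into \<open>Fs\<close> compatible with \<open>free_nu\<close> can therefore be seen
  to be an algebra homomorphism.\<close>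

lemma mult_free_nu:
  assumes X: "X \<in> Ob C"
  shows "mult Fs X \<cdot> free_nu (fobj A X) = fstr A X"
proof -
  note b = Fs_mult[OF X]
  have "mult Fs X \<cdot> free_nu (fobj A X) = fstr A X \<cdot> amap F (mult Fs X) \<cdot> amap F (funit A (fobj A X))"
    unfolding free_nu_def using X b by (simp add: Comp_eq_extend[OF b(5)])
  also have "\<dots> = fstr A X" using X b by (simp flip: amap_Comp_arr)
  finally show ?thesis .
qed

text \<open>The arrow \<open>mult M X \<cdot> \<rho> (omap M X)\<close> makes
  \<open>omap M X\<close> an \<open>F\<close>-algebra; the unit of \<open>M\<close> is extended
  along it.\<close>

definition monad_ext :: "('o, 'a) monad \<Rightarrow> ('o \<Rightarrow> 'a) \<Rightarrow> 'o \<Rightarrow> 'a" where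
  "monad_ext M \<rho> X = free_extension C F A (munit M X) (mult M X \<cdot> \<rho> (omap M X))"

text \<open>The existence part of the universal property of \<open>Fs\<close>. The components,
  \<open>amap M f\<close> and \<open>mult M X\<close> are algebra homomorphisms, so naturality and
  multiplicativity are checked on generators. The last claim serves the comparison with another free
  monad.\<close>

lemma monad_ext:
  assumes M: "monad C M" and \<rho>: "natural C F M \<rho>"
  shows "monad_morphism C Fs M (monad_ext M \<rho>)"
    and "X \<in> Ob C \<Longrightarrow> monad_ext M \<rho> X \<cdot> free_nu X = \<rho> X"
    and "X \<in> Ob C \<Longrightarrow> monad_ext M \<rho> X \<cdot> fstr A X = mult M X \<cdot> \<rho> (omap M X) \<cdot> amap F (monad_ext M \<rho> X)"
proof -
  interpret M: monad C M by fact
  note r [simp] = naturalD(1-3)[OF \<rho>]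
  note rn = naturalD(4)[OF \<rho>]
  let ?b = "\<lambda>X. mult M X \<cdot> \<rho> (omap M X)"
  let ?s = "monad_ext M \<rho>"
  have s [simp]: "?s X \<in> Ar C" "Dom C (?s X) = fobj A X" "Cod C (?s X) = omap M X"
    and su: "?s X \<cdot> funit A X = munit M X"
    and sf: "?s X \<cdot> fstr A X = ?b X \<cdot> amap F (?s X)" if "X \<in> Ob C" for X
    using that free_extension_arr[of "munit M X" X "omap M X" "?b X"]
    by (simp_all add: monad_ext_def)
  then show "X \<in> Ob C \<Longrightarrow> ?s X \<cdot> fstr A X = mult M X \<cdot> \<rho> (omap M X) \<cdot> amap F (?s X)" for X
    by simp
  \<comment> \<open>\<open>amap M f\<close> is a homomorphism between the algebras
    \<open>?b\<close>, by naturality of \<open>mult M\<close> and of \<rho>.\<close>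
  have bn: "amap M f \<cdot> ?b X = ?b Y \<cdot> amap F (amap M f)" if f: "f \<in> hom C X Y" for f X Y
  proof -
    note f' [simp] = homD[OF f]
    have "amap M f \<cdot> ?b X = mult M Y \<cdot> amap M (amap M f) \<cdot> \<rho> (omap M X)"
      using Comp_eq_extend2[OF M.mult_nat_arr[OF f'(1)], of "\<rho> (omap M X)"] by simp
    also have "\<dots> = ?b Y \<cdot> amap F (amap M f)"
      using rn[of "amap M f"] by simp
    finally show ?thesis .
  qed
  \<comment> \<open>\<open>mult M X\<close> is a homomorphism as well, by associativity and
    naturality of \<rho>.\<close>
  have bm: "mult M X \<cdot> ?b (omap M X) = ?b X \<cdot> amap F (mult M X)" if X: "X \<in> Ob C" for X
  proof -
    have "mult M X \<cdot> ?b (omap M X) = mult M X \<cdot> amap M (mult M X) \<cdot> \<rho> (omap M (omap M X))"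
      using X Comp_eq_extend2[OF M.mult_assoc[OF X], of "\<rho> (omap M (omap M X))"] by simp
    also have "\<dots> = ?b X \<cdot> amap F (mult M X)"
      using rn[of "mult M X"] X by simp
    finally show ?thesis .
  qed
  have nat: "?s Y \<cdot> amap Fs f = amap M f \<cdot> ?s X" if f: "f \<in> hom C X Y" for f X Y
  proof (rule free_unique[where b = "?b Y" and X = X and B = "omap M Y"])
    note f' = homD[OF f]
    note b = Fs_amap[OF f'(1), unfolded f'(2,3)]
    show "(?s Y \<cdot> amap Fs f) \<cdot> fstr A X = ?b Y \<cdot> amap F (?s Y \<cdot> amap Fs f)"
      by (rule alg_hom_Comp[where b = "fstr A Y"]) (use f' b sf in auto)
    show "(amap M f \<cdot> ?s X) \<cdot> fstr A X = ?b Y \<cdot> amap F (amap M f \<cdot> ?s X)"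
      by (rule alg_hom_Comp[where b = "?b X"]) (use f' b sf bn[OF f] in auto)
    show "(?s Y \<cdot> amap Fs f) \<cdot> funit A X = (amap M f \<cdot> ?s X) \<cdot> funit A X"
      using f' b su M.munit_nat_arr[OF f'(1)] Comp_eq_extend[OF su, of Y f] by simp
  qed (use homD[OF f] Fs_amap in auto)
  have mul: "?s X \<cdot> mult Fs X = mult M X \<cdot> amap M (?s X) \<cdot> ?s (fobj A X)" if X: "X \<in> Ob C" for X
  proof (rule free_unique[where b = "?b X" and X = "fobj A X" and B = "omap M X"])
    note b = Fs_mult[OF X]
    show "(?s X \<cdot> mult Fs X) \<cdot> fstr A (fobj A X) = ?b X \<cdot> amap F (?s X \<cdot> mult Fs X)"
      by (rule alg_hom_Comp[where b = "fstr A X"]) (use X b sf in auto)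
    \<comment> \<open>The right-hand side is a composite of three homomorphisms; the first two are
      pasted here, the third afterwards.\<close>
    have 1: "(amap M (?s X) \<cdot> ?s (fobj A X)) \<cdot> fstr A (fobj A X)
        = ?b (omap M X) \<cdot> amap F (amap M (?s X) \<cdot> ?s (fobj A X))"
      by (rule alg_hom_Comp[where b = "?b (fobj A X)"])
        (use X sf[of "fobj A X"] bn[of "?s X" "fobj A X" "omap M X"] in \<open>auto simp: hom_def\<close>)
    show "(mult M X \<cdot> amap M (?s X) \<cdot> ?s (fobj A X)) \<cdot> fstr A (fobj A X)
        = ?b X \<cdot> amap F (mult M X \<cdot> amap M (?s X) \<cdot> ?s (fobj A X))"
      by (rule alg_hom_Comp[where b = "?b (omap M X)", OF _ _ _ 1]) (use X bm[OF X] in auto)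
    show "(?s X \<cdot> mult Fs X) \<cdot> funit A (fobj A X)
        = (mult M X \<cdot> amap M (?s X) \<cdot> ?s (fobj A X)) \<cdot> funit A (fobj A X)"
      using X b su M.munit_nat_arr[of "?s X"] Comp_eq_extend[OF M.munit_left[OF X], of "?s X"] by simp
  qed (use X Fs_mult in auto)
  show "monad_morphism C Fs M ?s"
    using nat mul su by (auto simp: monad_morphism_def natural_def hom_def)
  show "?s X \<cdot> free_nu X = \<rho> X" if X: "X \<in> Ob C"
  proof -
    have "?s X \<cdot> free_nu X = ?b X \<cdot> amap F (?s X) \<cdot> amap F (funit A X)"
      unfolding free_nu_def using X Comp_eq_extend[OF sf[OF X], of "amap F (funit A X)"] by simp
    also have "\<dots> = mult M X \<cdot> \<rho> (omap M X) \<cdot> amap F (munit M X)"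
      using X su by (simp flip: amap_Comp_arr)
    also have "\<dots> = mult M X \<cdot> amap M (munit M X) \<cdot> \<rho> X"
      using rn[of "munit M X"] X by simp
    also have "\<dots> = \<rho> X"
      using X Comp_eq_extend[OF M.munit_right[OF X], of "\<rho> X"] by simp
    finally show ?thesis .
  qed
qed

end

section \<open>Monad morphisms and the uniqueness of free monads\<close>

lemma monad_morphismD:
  assumes "monad_morphism C M N \<sigma>"
  shows "X \<in> Ob C \<Longrightarrow> \<sigma> X \<in> Ar C" "X \<in> Ob C \<Longrightarrow> Dom C (\<sigma> X) = omap M X"
    "X \<in> Ob C \<Longrightarrow> Cod C (\<sigma> X) = omap N X"
    "f \<in> Ar C \<Longrightarrow> \<sigma> (Cod C f) \<cdot>\<^bsub>C\<^esub> amap M f = amap N f \<cdot>\<^bsub>C\<^esub> \<sigma> (Dom C f)"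
    "X \<in> Ob C \<Longrightarrow> \<sigma> X \<cdot>\<^bsub>C\<^esub> munit M X = munit N X"
    "X \<in> Ob C \<Longrightarrow> \<sigma> X \<cdot>\<^bsub>C\<^esub> mult M X = mult N X \<cdot>\<^bsub>C\<^esub> amap N (\<sigma> X) \<cdot>\<^bsub>C\<^esub> \<sigma> (omap M X)"
  using assms naturalD[of C M N \<sigma>] by (auto simp: monad_morphism_def)

lemma monad_morphism_Idt:
  assumes "monad C M"
  shows "monad_morphism C M M (\<lambda>X. Idt C (omap M X))"
proof -
  interpret monad C M by fact
  show ?thesis by (auto simp: monad_morphism_def natural_def hom_def)
qed

lemma monad_morphism_Comp:
  assumes M: "monad C M" and N: "monad C N" and L: "monad C L"
    and s: "monad_morphism C M N \<sigma>" and t: "monad_morphism C N L \<tau>"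
  shows "monad_morphism C M L (\<lambda>X. \<tau> X \<cdot>\<^bsub>C\<^esub> \<sigma> X)"
proof -
  interpret M: monad C M by fact
  interpret N: monad C N by fact
  interpret L: monad C L by fact
  note S [simp] = monad_morphismD(1-3,5)[OF s]
  note T [simp] = monad_morphismD(1-3,5)[OF t]
  note sn = monad_morphismD(4,6)[OF s]
  note tn = monad_morphismD(4,6)[OF t]
  have "(\<tau> Y \<cdot>\<^bsub>C\<^esub> \<sigma> Y) \<cdot>\<^bsub>C\<^esub> amap M f = amap L f \<cdot>\<^bsub>C\<^esub> \<tau> X \<cdot>\<^bsub>C\<^esub> \<sigma> X"
    if f: "f \<in> hom C X Y" for X Y f
  proof -
    note f' [simp] = M.homD[OF f]
    show ?thesis using sn(1)[OF f'(1)] M.Comp_eq_extend2[OF tn(1)[OF f'(1)], of "\<sigma> X"] by simp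
  qed
  moreover have "(\<tau> X \<cdot>\<^bsub>C\<^esub> \<sigma> X) \<cdot>\<^bsub>C\<^esub> mult M X
      = mult L X \<cdot>\<^bsub>C\<^esub> amap L (\<tau> X \<cdot>\<^bsub>C\<^esub> \<sigma> X) \<cdot>\<^bsub>C\<^esub> \<tau> (omap M X) \<cdot>\<^bsub>C\<^esub> \<sigma> (omap M X)"
    if X: "X \<in> Ob C" for X
  proof -
    have "(\<tau> X \<cdot>\<^bsub>C\<^esub> \<sigma> X) \<cdot>\<^bsub>C\<^esub> mult M X = (\<tau> X \<cdot>\<^bsub>C\<^esub> mult N X) \<cdot>\<^bsub>C\<^esub> amap N (\<sigma> X) \<cdot>\<^bsub>C\<^esub> \<sigma> (omap M X)"
      using X sn(2) by simp
    also have "\<dots> = mult L X \<cdot>\<^bsub>C\<^esub> amap L (\<tau> X) \<cdot>\<^bsub>C\<^esub> (\<tau> (omap N X) \<cdot>\<^bsub>C\<^esub> amap N (\<sigma> X)) \<cdot>\<^bsub>C\<^esub> \<sigma> (omap M X)"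
      using X by (simp add: tn(2)[OF X] del: M.Comp_assoc_arr) simp
    \<comment> \<open>Naturality of \<tau> at the arrow \<open>\<sigma> X\<close> exchanges the two
      inner factors, so that functoriality of \<open>L\<close> can collect \<sigma> and
      \<tau>.\<close>
    also have "\<dots> = mult L X \<cdot>\<^bsub>C\<^esub> amap L (\<tau> X) \<cdot>\<^bsub>C\<^esub> (amap L (\<sigma> X) \<cdot>\<^bsub>C\<^esub> \<tau> (omap M X)) \<cdot>\<^bsub>C\<^esub> \<sigma> (omap M X)"
      using X tn(1)[of "\<sigma> X"] by (simp del: M.Comp_assoc_arr)
    also have "\<dots> = mult L X \<cdot>\<^bsub>C\<^esub> amap L (\<tau> X \<cdot>\<^bsub>C\<^esub> \<sigma> X) \<cdot>\<^bsub>C\<^esub> \<tau> (omap M X) \<cdot>\<^bsub>C\<^esub> \<sigma> (omap M X)"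
      using X by (simp add: L.amap_Comp_arr)
    finally show ?thesis .
  qed
  moreover have "(\<tau> X \<cdot>\<^bsub>C\<^esub> \<sigma> X) \<cdot>\<^bsub>C\<^esub> munit M X = munit L X" if "X \<in> Ob C" for X
    using that by simp
  ultimately show ?thesis by (auto simp: monad_morphism_def natural_def hom_def)
qed

text \<open>Monad morphisms \<sigma> and \<tau> between \<open>Fs\<close> and \<open>M\<close> come
  from \<open>monad_ext\<close> and \<open>nu_universal\<close>. One composite is the identity by
  uniqueness for \<open>M\<close>, the other by \<open>free_unique\<close>, since it is an algebra
  homomorphism fixing the generators.\<close>

lemma free_monad_over_iso:
  assumes "free_monad_over C F M \<nu>" and "free_algebras C F A" and X: "X \<in> Ob C"
  shows "\<exists>s t. s \<in> hom C (fobj A X) (omap M X) \<and> t \<in> hom C (omap M X) (fobj A X) \<and>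
    s \<cdot>\<^bsub>C\<^esub> t = Idt C (omap M X) \<and> t \<cdot>\<^bsub>C\<^esub> s = Idt C (fobj A X) \<and>
    s \<cdot>\<^bsub>C\<^esub> funit A X = munit M X \<and> s \<cdot>\<^bsub>C\<^esub> fstr A X \<cdot>\<^bsub>C\<^esub> amap F (funit A X) = \<nu> X"
proof -
  interpret free_algebras C F A by fact
  interpret U: free_monad_over C F M \<nu> by fact
  have M: "monad C M" by (rule U.M.monad_axioms)
  interpret Fs: monad C Fs by (rule free_monad_monad)
  note \<nu> [simp] = naturalD(1-3)[OF U.nu_natural]
  define \<sigma> where "\<sigma> = monad_ext M \<nu>"
  note \<sigma> = monad_ext[OF M U.nu_natural, folded \<sigma>_def]
  note \<sigma>' [simp] = monad_morphismD(1-3,5)[OF \<sigma>(1)]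
  obtain \<tau> where \<tau>: "monad_morphism C M Fs \<tau>" "\<And>X. X \<in> Ob C \<Longrightarrow> \<tau> X \<cdot>\<^bsub>C\<^esub> \<nu> X = free_nu X"
    using U.nu_universal[OF free_monad_monad free_nu_natural] by blast
  note \<tau>' [simp] = monad_morphismD(1-3,5)[OF \<tau>(1)]
  note \<tau>m = monad_morphismD(6)[OF \<tau>(1)]
  have mor: "monad_morphism C M M (\<lambda>X. \<sigma> X \<cdot>\<^bsub>C\<^esub> \<tau> X)"
    by (rule monad_morphism_Comp[OF M free_monad_monad M \<tau>(1) \<sigma>(1)])
  have "(\<sigma> Y \<cdot>\<^bsub>C\<^esub> \<tau> Y) \<cdot>\<^bsub>C\<^esub> \<nu> Y = \<nu> Y" if "Y \<in> Ob C" for Y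
    using that \<tau>(2) \<sigma>(2) by simp
  moreover have "Idt C (omap M Y) \<cdot>\<^bsub>C\<^esub> \<nu> Y = \<nu> Y" if "Y \<in> Ob C" for Y
    using that by simp
  \<comment> \<open>The composite and the identity are both monad endomorphisms of \<open>M\<close>
    that fix \<nu>.\<close>
  ultimately have st: "\<sigma> X \<cdot>\<^bsub>C\<^esub> \<tau> X = Idt C (omap M X)"
    using U.nu_universal[OF M U.nu_natural] mor monad_morphism_Idt[OF M] X by (metis (no_types, lifting))
  \<comment> \<open>The chain shows that \<open>\<tau> X\<close> is a homomorphism from the algebra
    on \<open>omap M X\<close> induced by \<nu> to the free algebra.\<close>
  have "\<tau> X \<cdot>\<^bsub>C\<^esub> mult M X \<cdot>\<^bsub>C\<^esub> \<nu> (omap M X) = mult Fs X \<cdot>\<^bsub>C\<^esub> amap Fs (\<tau> X) \<cdot>\<^bsub>C\<^esub> \<tau> (omap M X) \<cdot>\<^bsub>C\<^esub> \<nu> (omap M X)"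
    using Comp_eq_extend[OF \<tau>m[OF X], of "\<nu> (omap M X)"] X by simp
  also have "\<dots> = mult Fs X \<cdot>\<^bsub>C\<^esub> amap Fs (\<tau> X) \<cdot>\<^bsub>C\<^esub> free_nu (omap M X)"
    using \<tau>(2)[of "omap M X"] X by simp
  also have "\<dots> = mult Fs X \<cdot>\<^bsub>C\<^esub> free_nu (fobj A X) \<cdot>\<^bsub>C\<^esub> amap F (\<tau> X)"
    using naturalD(4)[OF free_nu_natural, of "\<tau> X"] X by simp
  also have "\<dots> = fstr A X \<cdot>\<^bsub>C\<^esub> amap F (\<tau> X)"
    using Comp_eq_extend[OF mult_free_nu[OF X], of "amap F (\<tau> X)"] X Fs.mult_arr[OF X] by simp
  finally have t: "\<tau> X \<cdot>\<^bsub>C\<^esub> (mult M X \<cdot>\<^bsub>C\<^esub> \<nu> (omap M X)) = fstr A X \<cdot>\<^bsub>C\<^esub> amap F (\<tau> X)" .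
  have ts: "\<tau> X \<cdot>\<^bsub>C\<^esub> \<sigma> X = Idt C (fobj A X)"
  proof (rule free_unique[where b = "fstr A X" and X = X and B = "fobj A X"])
    show "(\<tau> X \<cdot>\<^bsub>C\<^esub> \<sigma> X) \<cdot>\<^bsub>C\<^esub> fstr A X = fstr A X \<cdot>\<^bsub>C\<^esub> amap F (\<tau> X \<cdot>\<^bsub>C\<^esub> \<sigma> X)"
      by (rule alg_hom_Comp[where b = "mult M X \<cdot>\<^bsub>C\<^esub> \<nu> (omap M X)" and B = "omap M X" and D = "fobj A X"])
        (use X \<sigma>(3)[OF X] t in auto)
    have "\<sigma> X \<cdot>\<^bsub>C\<^esub> funit A X = munit M X" "\<tau> X \<cdot>\<^bsub>C\<^esub> munit M X = funit A X"
      using \<sigma>'(4)[OF X] \<tau>'(4)[OF X] by simp_all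
    then show "(\<tau> X \<cdot>\<^bsub>C\<^esub> \<sigma> X) \<cdot>\<^bsub>C\<^esub> funit A X = Idt C (fobj A X) \<cdot>\<^bsub>C\<^esub> funit A X"
      using X by simp
  qed (use X in auto)
  show ?thesis
    using st ts X \<sigma>(2)[OF X] \<sigma>'(4)[OF X]
    by (intro exI[of _ "\<sigma> X"] exI[of _ "\<tau> X"]) (auto simp: hom_def free_nu_def)
qed

section \<open>Free algebras in the Kleisli category\<close>

definition Kl_free_algs :: "('o, 'a) category \<Rightarrow> ('o, 'a) monad \<Rightarrow> ('o, 'a) free_algs
    \<Rightarrow> ('o, 'o \<times> 'a \<times> 'o) free_algs" where
  "Kl_free_algs C T A =
     \<lparr>fobj = fobj A, funit = (\<lambda>X. sharp C T (funit A X)), fstr = (\<lambda>X. sharp C T (fstr A X))\<rparr>"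

context monad
begin

lemma sharp_hom:
  assumes "f \<in> hom C X Y"
  shows "sharp C T f \<in> hom (Kl C T) X Y"
  using homD[OF assms] Comp_hom[OF assms munit_hom] by (auto simp: Kl_hom sharp_def)

lemma sharp_Comp:
  assumes f: "f \<in> hom C X Y" and g: "g \<in> hom C Y Z"
  shows "sharp C T (g \<cdot> f) = sharp C T g \<cdot>\<^bsub>Kl C T\<^esub> sharp C T f"
proof -
  note f' = homD[OF f] and g' = homD[OF g]
  have "sharp C T g = (Y, munit T Z \<cdot> g, Z)" using g' by (simp add: sharp_def)
  then show ?thesis
    using sharp_comp_right[OF f Comp_hom[OF g munit_hom[OF g'(5)]] g'(5)] f' g'
    by (simp add: sharp_def)
qed

text \<open>\<open>munit_right\<close> cancels the multiplication. With
  \<open>sharp_comp_right\<close>, Kleisli squares along pure arrows become squares in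
  \<open>C\<close>; coalgebra homomorphisms are translated in this way.\<close>

lemma sharp_comp_left:
  assumes f: "f \<in> hom C X (omap T Y)" and g: "g \<in> hom C Y Z"
  shows "sharp C T g \<cdot>\<^bsub>Kl C T\<^esub> (X, f, Y) = (X, amap T g \<cdot> f, Z)"
proof -
  note f' = homD[OF f] and g' = homD[OF g]
  have "mult T Z \<cdot> amap T (munit T Z \<cdot> g) \<cdot> f = (mult T Z \<cdot> amap T (munit T Z)) \<cdot> amap T g \<cdot> f"
    using f' g' by (simp add: amap_Comp_arr)
  also have "\<dots> = amap T g \<cdot> f" using f' g' munit_right[OF g'(5)] by simp
  finally show ?thesis using g' by (simp add: sharp_def Kl_sel)
qed

text \<open>A Kleisli arrow \<open>k : Y \<multimap> B\<close> factors as \<open>\<epsilon> \<cdot> k\<^sup>\<sharp>\<close> with \<open>\<epsilon> = id : T B \<multimap> B\<close>, so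
  \<open>b \<cdot> F' k = (b \<cdot> F' \<epsilon>) \<circ> F k\<close> and \<open>F'\<close>-algebra homomorphisms into \<open>B\<close> are \<open>F\<close>-algebra
  homomorphisms into \<open>T B\<close>.\<close>

lemma Kl_free_algebras:
  assumes "free_algebras C F A" and lifts: "lifts C T F F'"
  shows "free_algebras (Kl C T) F' (Kl_free_algs C T A)"
proof -
  interpret A: free_algebras C F A by fact
  interpret K: category "Kl C T" by (rule Kl_category)
  interpret F': endofunctor "Kl C T" F' using lifts by (simp add: lifts_def)
  have F'o: "X \<in> Ob C \<Longrightarrow> omap F' X = omap F X"
    and F's: "f \<in> Ar C \<Longrightarrow> amap F' (sharp C T f) = sharp C T (amap F f)" for X f
    using lifts by (auto simp: lifts_def)
  show ?thesis
  proof
    fix \<phi> b X B assume \<phi>: "\<phi> \<in> hom (Kl C T) X B" and b: "b \<in> hom (Kl C T) (omap F' B) B"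
    then obtain f where f: "f \<in> hom C X (omap T B)" "\<phi> = (X, f, B)" and ob: "X \<in> Ob C" "B \<in> Ob C"
      by (auto simp: Kl_hom)
    have tb: "omap T B \<in> Ob C" using ob by simp
    define \<epsilon> where "\<epsilon> = (omap T B, Idt C (omap T B), B)"
    have \<epsilon>: "\<epsilon> \<in> hom (Kl C T) (omap T B) B" using ob Idt_hom[OF tb] by (auto simp: \<epsilon>_def Kl_hom)
    have "b \<cdot>\<^bsub>Kl C T\<^esub> amap F' \<epsilon> \<in> hom (Kl C T) (omap F (omap T B)) B"
      using K.Comp_hom[OF F'.amap_hom[OF \<epsilon>] b] F'o[OF tb] by simp
    then obtain c where c: "c \<in> hom C (omap F (omap T B)) (omap T B)"
        "b \<cdot>\<^bsub>Kl C T\<^esub> amap F' \<epsilon> = (omap F (omap T B), c, B)"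
      by (auto simp: Kl_hom)
    have key: "b \<cdot>\<^bsub>Kl C T\<^esub> amap F' (fobj A X, k, B) = (omap F (fobj A X), c \<cdot> amap F k, B)"
      if k: "k \<in> hom C (fobj A X) (omap T B)" for k
    proof -
      note sk = sharp_hom[OF k] and k' = homD[OF k]
      have "(fobj A X, k, B) = \<epsilon> \<cdot>\<^bsub>Kl C T\<^esub> sharp C T k"
        unfolding \<epsilon>_def using sharp_comp_right[OF k Idt_hom[OF tb] ob(2)] k' by simp
      then have "b \<cdot>\<^bsub>Kl C T\<^esub> amap F' (fobj A X, k, B)
          = b \<cdot>\<^bsub>Kl C T\<^esub> amap F' \<epsilon> \<cdot>\<^bsub>Kl C T\<^esub> sharp C T (amap F k)"
        using F'.amap_Comp[OF sk \<epsilon>] F's[OF k'(1)] by simp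
      also have "\<dots> = (b \<cdot>\<^bsub>Kl C T\<^esub> amap F' \<epsilon>) \<cdot>\<^bsub>Kl C T\<^esub> sharp C T (amap F k)"
        using K.Comp_assoc[OF _ F'.amap_hom[OF \<epsilon>] b] sharp_hom[OF A.amap_hom[OF k]] F'o[OF tb] by simp
      also have "\<dots> = (omap F (fobj A X), c \<cdot> amap F k, B)"
        unfolding c(2) by (rule sharp_comp_right[OF A.amap_hom[OF k] c(1) ob(2)])
      finally show ?thesis .
    qed
    \<comment> \<open>By \<open>key\<close>, a Kleisli homomorphism into \<open>b\<close> is the
      same as a homomorphism over \<open>C\<close> into the algebra \<open>c\<close> on
      \<open>omap T B\<close>, so unique existence carries over.\<close>
    have e: "(\<kappa> \<in> hom (Kl C T) (fobj A X) B \<and> \<kappa> \<cdot>\<^bsub>Kl C T\<^esub> sharp C T (funit A X) = \<phi> \<and>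
          \<kappa> \<cdot>\<^bsub>Kl C T\<^esub> sharp C T (fstr A X) = b \<cdot>\<^bsub>Kl C T\<^esub> amap F' \<kappa>)
        \<longleftrightarrow> (\<exists>k. \<kappa> = (fobj A X, k, B) \<and> k \<in> hom C (fobj A X) (omap T B) \<and> k \<cdot> funit A X = f \<and>
          k \<cdot> fstr A X = c \<cdot> amap F k)" for \<kappa>
      using sharp_comp_right[OF A.funit_hom[OF ob(1)] _ ob(2)] sharp_comp_right[OF A.fstr_hom[OF ob(1)] _ ob(2)]
        key f ob by (auto simp: Kl_hom)
    show "\<exists>!k. k \<in> hom (Kl C T) (fobj (Kl_free_algs C T A) X) B \<and>
         k \<cdot>\<^bsub>Kl C T\<^esub> funit (Kl_free_algs C T A) X = \<phi> \<and>
         k \<cdot>\<^bsub>Kl C T\<^esub> fstr (Kl_free_algs C T A) X = b \<cdot>\<^bsub>Kl C T\<^esub> amap F' k"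
      using A.free_universal[OF f(1) c(1)] by (simp add: Kl_free_algs_def e) blast
  qed (auto simp: Kl_free_algs_def Kl_sel F'o intro!: sharp_hom A.funit_hom A.fstr_hom)
qed

end

section \<open>Coproducts\<close>

context binary_coproducts
begin

lemma cotuple:
  assumes f: "f \<in> hom C X Z" and g: "g \<in> hom C Y Z"
  shows "cotuple C P f g \<in> hom C (csum P X Y) Z"
    "cotuple C P f g \<cdot> inj1 P X Y = f" "cotuple C P f g \<cdot> inj2 P X Y = g"
proof -
  have "Dom C f = X" "Dom C g = Y" "Cod C f = Z" using homD[OF f] homD[OF g] by auto
  with theI'[OF csum_universal[OF f g]]
  show "cotuple C P f g \<in> hom C (csum P X Y) Z"
    "cotuple C P f g \<cdot> inj1 P X Y = f" "cotuple C P f g \<cdot> inj2 P X Y = g"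
    by (simp_all add: cotuple_def)
qed

lemma csum_ext:
  assumes h: "h \<in> hom C (csum P X Y) Z" and k: "k \<in> hom C (csum P X Y) Z"
    and ob: "X \<in> Ob C" "Y \<in> Ob C"
    and 1: "h \<cdot> inj1 P X Y = k \<cdot> inj1 P X Y" and 2: "h \<cdot> inj2 P X Y = k \<cdot> inj2 P X Y"
  shows "h = k"
  using csum_universal[OF Comp_hom[OF inj1_hom[OF ob] h] Comp_hom[OF inj2_hom[OF ob] h]] assms
  by metis

lemma sum_map:
  assumes f: "f \<in> hom C X X'" and g: "g \<in> hom C Y Y'"
  shows "sum_map C P f g \<in> hom C (csum P X Y) (csum P X' Y')"
    "sum_map C P f g \<cdot> inj1 P X Y = inj1 P X' Y' \<cdot> f"
    "sum_map C P f g \<cdot> inj2 P X Y = inj2 P X' Y' \<cdot> g"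
proof -
  note f' = homD[OF f] and g' = homD[OF g]
  have "sum_map C P f g = cotuple C P (inj1 P X' Y' \<cdot> f) (inj2 P X' Y' \<cdot> g)"
    using f' g' by (simp add: sum_map_def)
  with cotuple[OF Comp_hom[OF f inj1_hom] Comp_hom[OF g inj2_hom]] f' g'
  show "sum_map C P f g \<in> hom C (csum P X Y) (csum P X' Y')"
    "sum_map C P f g \<cdot> inj1 P X Y = inj1 P X' Y' \<cdot> f"
    "sum_map C P f g \<cdot> inj2 P X Y = inj2 P X' Y' \<cdot> g"
    by simp_all
qed

end

context monad
begin

text \<open>The Kleisli coprojections are the images of those of \<open>C\<close>, and
  \<open>sharp\<close> preserves composition, so both sides restrict alike.\<close>

lemma cotuple_sharp:
  assumes "binary_coproducts C P" and f: "f \<in> hom C X Z" and g: "g \<in> hom C Y Z"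
  shows "cotuple (Kl C T) (Kl_coproducts C T P) (sharp C T f) (sharp C T g) = sharp C T (cotuple C P f g)"
proof -
  interpret P: binary_coproducts C P by fact
  interpret Q: binary_coproducts "Kl C T" "Kl_coproducts C T P"
    using Kl_binary_coproducts assms(1) .
  have ob: "X \<in> Ob C" "Y \<in> Ob C" using homD[OF f] homD[OF g] by auto
  note i = P.inj1_hom[OF ob] P.inj2_hom[OF ob]
  note c = P.cotuple[OF f g] and d = Q.cotuple[OF sharp_hom[OF f] sharp_hom[OF g]]
  have s: "csum (Kl_coproducts C T P) X Y = csum P X Y"
      "inj1 (Kl_coproducts C T P) X Y = sharp C T (inj1 P X Y)"
      "inj2 (Kl_coproducts C T P) X Y = sharp C T (inj2 P X Y)"
    by (simp_all add: Kl_coproducts_def)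
  show ?thesis
    by (rule Q.csum_ext[OF d(1)])
      (use ob d sharp_hom[OF c(1)] sharp_Comp[OF i(1) c(1)] sharp_Comp[OF i(2) c(1)] c
        in \<open>simp_all add: Kl_sel s\<close>)
qed

text \<open>This makes \<open>plus_Id C P F\<close> lift once \<open>F\<close> does; see
  \<open>amap_lifts\<close>.\<close>

lemma sum_map_sharp:
  assumes P: "binary_coproducts C P" and f: "f \<in> hom C X X'" and g: "g \<in> hom C Y Y'"
  shows "sum_map (Kl C T) (Kl_coproducts C T P) (sharp C T f) (sharp C T g) = sharp C T (sum_map C P f g)"
proof -
  interpret P: binary_coproducts C P by fact
  interpret K: category "Kl C T" by (rule Kl_category)
  note f' = homD[OF f] and g' = homD[OF g]
  note i = P.inj1_hom[OF f'(5) g'(5)] P.inj2_hom[OF f'(5) g'(5)]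
  show ?thesis
    using cotuple_sharp[OF P Comp_hom[OF f i(1)] Comp_hom[OF g i(2)]]
      sharp_Comp[OF f i(1)] sharp_Comp[OF g i(2)] K.homD[OF sharp_hom[OF f]] K.homD[OF sharp_hom[OF g]] f' g'
    by (simp add: sum_map_def Kl_coproducts_def)
qed

end

section \<open>Saturation\<close>

context order_saturation_monad
begin

text \<open>\<open>star \<beta>\<close> is reflexive, transitive and above \<alpha>, so minimality
  of \<open>star \<alpha>\<close> applies.\<close>

lemma star_mono:
  assumes "\<alpha> \<in> hom (Kl C T) X X" "\<beta> \<in> hom (Kl C T) X X" "le \<alpha> \<beta>"
  shows "le (star \<alpha>) (star \<beta>)"
  using assms by (meson Kl.le_trans star_hom star_incl star_least star_refl star_trans)

text \<open>\<open>star \<alpha>\<close> already satisfies the conditions of which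
  \<open>star (star \<alpha>)\<close> is the least solution.\<close>

lemma star_star:
  assumes "\<alpha> \<in> hom (Kl C T) X X"
  shows "star (star \<alpha>) = star \<alpha>"
  using assms
  by (meson Kl.le_antisym Kl.le_refl star_hom star_incl star_least star_refl star_trans)

text \<open>Condition (e) extends from arrows \<open>k\<^sup>\<sharp>\<close> to \<open>s \<cdot> k\<^sup>\<sharp>\<close> with \<open>s\<close> invertible, since
  saturation commutes with conjugation by \<open>s\<close>.\<close>

lemma star_le_iso:
  assumes k: "k \<in> hom C U V" and s: "s \<in> hom (Kl C T) V W" and t: "t \<in> hom (Kl C T) W V"
    and st: "s \<cdot>\<^bsub>Kl C T\<^esub> t = Idt (Kl C T) W" and ts: "t \<cdot>\<^bsub>Kl C T\<^esub> s = Idt (Kl C T) V"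
    and n: "n = s \<cdot>\<^bsub>Kl C T\<^esub> sharp C T k"
    and B: "\<beta> \<in> hom (Kl C T) U U" and A: "\<alpha> \<in> hom (Kl C T) W W"
    and le: "le (n \<cdot>\<^bsub>Kl C T\<^esub> \<beta>) (\<alpha> \<cdot>\<^bsub>Kl C T\<^esub> n)"
  shows "le (n \<cdot>\<^bsub>Kl C T\<^esub> star \<beta>) (star \<alpha> \<cdot>\<^bsub>Kl C T\<^esub> n)"
proof -
  let ?k = "sharp C T k"
  note kh = sharp_hom[OF k]
  note sA = star_hom[OF A] and sB = star_hom[OF B]
  note [simp] = Kl.homD[OF kh] Kl.homD[OF s] Kl.homD[OF t] Kl.homD[OF A] Kl.homD[OF B]
    Kl.homD[OF sA] Kl.homD[OF sB]
  have tsx: "t \<cdot>\<^bsub>Kl C T\<^esub> s \<cdot>\<^bsub>Kl C T\<^esub> x = x" if "x \<in> Ar (Kl C T)" "Cod (Kl C T) x = V" for x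
    using Kl.Comp_eq_extend[OF ts, of x] that by simp
  have stx: "s \<cdot>\<^bsub>Kl C T\<^esub> t \<cdot>\<^bsub>Kl C T\<^esub> x = x" if "x \<in> Ar (Kl C T)" "Cod (Kl C T) x = W" for x
    using Kl.Comp_eq_extend[OF st, of x] that by simp
  \<comment> \<open>\<open>d\<close> and \<open>e\<close> are \<alpha> and
    \<open>star \<alpha>\<close> conjugated by \<open>s\<close>. Condition (e) is applied to
    \<open>k\<close> and \<open>d\<close>; then \<open>star d\<close> is replaced by the larger
    \<open>e\<close>.\<close>
  define d where "d = t \<cdot>\<^bsub>Kl C T\<^esub> \<alpha> \<cdot>\<^bsub>Kl C T\<^esub> s"
  define e where "e = t \<cdot>\<^bsub>Kl C T\<^esub> star \<alpha> \<cdot>\<^bsub>Kl C T\<^esub> s"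
  have d: "d \<in> hom (Kl C T) V V" and e: "e \<in> hom (Kl C T) V V"
    by (auto simp: d_def e_def hom_def)
  note sd = star_hom[OF d]
  note [simp] = Kl.homD[OF d] Kl.homD[OF e] Kl.homD[OF sd]
  have conj_mono: "le (t \<cdot>\<^bsub>Kl C T\<^esub> x \<cdot>\<^bsub>Kl C T\<^esub> s) (t \<cdot>\<^bsub>Kl C T\<^esub> y \<cdot>\<^bsub>Kl C T\<^esub> s)"
    if "x \<in> hom (Kl C T) W W" "y \<in> hom (Kl C T) W W" "le x y" for x y
    using that s t by (meson Kl.Comp_hom Kl.Comp_mono Kl.le_refl)
  have "le (t \<cdot>\<^bsub>Kl C T\<^esub> n \<cdot>\<^bsub>Kl C T\<^esub> \<beta>) (t \<cdot>\<^bsub>Kl C T\<^esub> \<alpha> \<cdot>\<^bsub>Kl C T\<^esub> n)"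
    by (rule Kl.Comp_mono[OF _ _ t t le Kl.le_refl[OF t]]) (auto simp: hom_def n)
  then have "le (?k \<cdot>\<^bsub>Kl C T\<^esub> \<beta>) (d \<cdot>\<^bsub>Kl C T\<^esub> ?k)"
    by (simp add: n d_def tsx)
  from star_le[OF k B d this]
  have 1: "le (?k \<cdot>\<^bsub>Kl C T\<^esub> star \<beta>) (star d \<cdot>\<^bsub>Kl C T\<^esub> ?k)" .
  \<comment> \<open>Minimality of \<open>star d\<close>: conjugation is monotone and,
    \<open>s\<close> and \<open>t\<close> being inverse, preserves identity and composition.\<close>
  have 2: "le (star d) e"
  proof (rule star_least[OF d e])
    have "le (t \<cdot>\<^bsub>Kl C T\<^esub> Idt (Kl C T) W \<cdot>\<^bsub>Kl C T\<^esub> s) e"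
      unfolding e_def by (rule conj_mono[OF Kl.Idt_hom sA star_refl[OF A]]) simp
    then show "le (Idt (Kl C T) V) e" by (simp add: ts)
    show "le d e" unfolding d_def e_def by (rule conj_mono[OF A sA star_incl[OF A]])
    have "e \<cdot>\<^bsub>Kl C T\<^esub> e = t \<cdot>\<^bsub>Kl C T\<^esub> (star \<alpha> \<cdot>\<^bsub>Kl C T\<^esub> star \<alpha>) \<cdot>\<^bsub>Kl C T\<^esub> s"
      by (simp add: e_def stx)
    then show "le (e \<cdot>\<^bsub>Kl C T\<^esub> e) e"
      using conj_mono[OF Kl.Comp_hom[OF sA sA] sA star_trans[OF A]] by (simp add: e_def)
  qed
  have "le (star d \<cdot>\<^bsub>Kl C T\<^esub> ?k) (e \<cdot>\<^bsub>Kl C T\<^esub> ?k)"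
    by (rule Kl.Comp_mono[OF kh kh sd e Kl.le_refl[OF kh] 2])
  with 1 have "le (?k \<cdot>\<^bsub>Kl C T\<^esub> star \<beta>) (e \<cdot>\<^bsub>Kl C T\<^esub> ?k)"
    using Kl.le_trans Kl.Comp_hom kh sB sd e by meson
  then have "le (s \<cdot>\<^bsub>Kl C T\<^esub> ?k \<cdot>\<^bsub>Kl C T\<^esub> star \<beta>) (s \<cdot>\<^bsub>Kl C T\<^esub> e \<cdot>\<^bsub>Kl C T\<^esub> ?k)"
    by (intro Kl.Comp_mono[OF _ _ s s _ Kl.le_refl[OF s]]) (auto simp: hom_def)
  then show ?thesis by (simp add: n e_def stx)
qed

section \<open>Saturation for a monad on the Kleisli category\<close>

lemma saturate_in_hom:
  assumes "monad (Kl C T) S" and \<alpha>: "\<alpha> \<in> hom (Kl C T) X (omap S X)"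
  shows "mult S X \<cdot>\<^bsub>Kl C T\<^esub> amap S \<alpha> \<in> hom (Kl C T) (omap S X) (omap S X)"
    and "saturate (Kl C T) star S \<alpha> = star (mult S X \<cdot>\<^bsub>Kl C T\<^esub> amap S \<alpha>) \<cdot>\<^bsub>Kl C T\<^esub> munit S X"
    and "saturate (Kl C T) star S \<alpha> \<in> hom (Kl C T) X (omap S X)"
proof -
  interpret S: monad "Kl C T" S by fact
  note \<alpha>' = Kl.homD[OF \<alpha>]
  show 1: "mult S X \<cdot>\<^bsub>Kl C T\<^esub> amap S \<alpha> \<in> hom (Kl C T) (omap S X) (omap S X)"
    using \<alpha>' by (auto simp: hom_def)
  show 2: "saturate (Kl C T) star S \<alpha> = star (mult S X \<cdot>\<^bsub>Kl C T\<^esub> amap S \<alpha>) \<cdot>\<^bsub>Kl C T\<^esub> munit S X"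
    using \<alpha>' by (simp add: saturate_def)
  show "saturate (Kl C T) star S \<alpha> \<in> hom (Kl C T) X (omap S X)"
    unfolding 2 by (rule Kl.Comp_hom[OF S.munit_hom star_hom[OF 1]]) (use \<alpha>' in simp)
qed

text \<open>The square for \<alpha> and \<gamma> induces one for the endomorphisms under
  \<open>star\<close>, with \<open>sharp C T h\<close> on both sides. As that arrow is pure,
  condition (e) applies; restriction along the unit finishes.\<close>

lemma saturate_preserves_hom:
  assumes S: "monad (Kl C T) S" and f: "f \<in> hom C X Z"
    and h: "h \<in> hom C (omap S X) (omap S Z)" "amap S (sharp C T f) = sharp C T h"
    and \<alpha>: "\<alpha> \<in> hom (Kl C T) X (omap S X)" and \<gamma>: "\<gamma> \<in> hom (Kl C T) Z (omap S Z)"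
    and eq: "sharp C T h \<cdot>\<^bsub>Kl C T\<^esub> \<alpha> = \<gamma> \<cdot>\<^bsub>Kl C T\<^esub> sharp C T f"
  shows "sharp C T h \<cdot>\<^bsub>Kl C T\<^esub> saturate (Kl C T) star S \<alpha>
    = saturate (Kl C T) star S \<gamma> \<cdot>\<^bsub>Kl C T\<^esub> sharp C T f"
proof -
  interpret S: monad "Kl C T" S by fact
  let ?f = "sharp C T f" and ?h = "sharp C T h"
  let ?a = "mult S X \<cdot>\<^bsub>Kl C T\<^esub> amap S \<alpha>" and ?c = "mult S Z \<cdot>\<^bsub>Kl C T\<^esub> amap S \<gamma>"
  note a = saturate_in_hom[OF S \<alpha>] and c = saturate_in_hom[OF S \<gamma>]
  note fh = sharp_hom[OF f] and hh = sharp_hom[OF h(1)]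
  note [simp] = Kl.homD[OF fh] Kl.homD[OF hh] Kl.homD[OF \<alpha>] Kl.homD[OF \<gamma>]
    Kl.homD[OF star_hom[OF a(1)]] Kl.homD[OF star_hom[OF c(1)]]
  have "?h \<cdot>\<^bsub>Kl C T\<^esub> ?a = mult S Z \<cdot>\<^bsub>Kl C T\<^esub> amap S ?h \<cdot>\<^bsub>Kl C T\<^esub> amap S \<alpha>"
    using Kl.Comp_eq_extend2[OF S.mult_nat[OF fh], of "amap S \<alpha>"] by (simp add: h(2))
  also have "\<dots> = mult S Z \<cdot>\<^bsub>Kl C T\<^esub> amap S (\<gamma> \<cdot>\<^bsub>Kl C T\<^esub> ?f)"
    by (simp add: eq flip: S.amap_Comp_arr)
  also have "\<dots> = ?c \<cdot>\<^bsub>Kl C T\<^esub> ?h"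
    by (simp add: S.amap_Comp_arr h(2))
  finally have e: "?h \<cdot>\<^bsub>Kl C T\<^esub> ?a = ?c \<cdot>\<^bsub>Kl C T\<^esub> ?h" .
  note r = Kl.le_refl[OF Kl.Comp_hom[OF a(1) hh]]
  \<comment> \<open>The equation \<open>e\<close> is read as two inequalities, one for each
    direction of condition (e).\<close>
  have star: "?h \<cdot>\<^bsub>Kl C T\<^esub> star ?a = star ?c \<cdot>\<^bsub>Kl C T\<^esub> ?h"
    using star_le[OF h(1) a(1) c(1)] star_ge[OF h(1) a(1) c(1)] r
      Kl.le_antisym[OF Kl.Comp_hom[OF star_hom[OF a(1)] hh] Kl.Comp_hom[OF hh star_hom[OF c(1)]]]
    unfolding e by blast
  have "?h \<cdot>\<^bsub>Kl C T\<^esub> saturate (Kl C T) star S \<alpha> = star ?c \<cdot>\<^bsub>Kl C T\<^esub> ?h \<cdot>\<^bsub>Kl C T\<^esub> munit S X"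
    unfolding a(2) using Kl.Comp_eq_extend2[OF star, of "munit S X"] by simp
  also have "\<dots> = saturate (Kl C T) star S \<gamma> \<cdot>\<^bsub>Kl C T\<^esub> ?f"
    unfolding c(2) using S.munit_nat[OF fh] by (simp add: h(2))
  finally show ?thesis .
qed

text \<open>Restricting \<open>mult S X \<cdot> amap S \<alpha>\<close> along the unit gives back
  \<alpha>, so \<open>star_incl\<close> restricts to the claim.\<close>

lemma saturate_incl:
  assumes S: "monad (Kl C T) S" and \<alpha>: "\<alpha> \<in> hom (Kl C T) X (omap S X)"
  shows "le \<alpha> (saturate (Kl C T) star S \<alpha>)"
proof -
  interpret S: monad "Kl C T" S by fact
  note a = saturate_in_hom[OF S \<alpha>] and \<alpha>' = Kl.homD[OF \<alpha>]
  note e = S.munit_hom[OF \<alpha>'(4)]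
  have "(mult S X \<cdot>\<^bsub>Kl C T\<^esub> amap S \<alpha>) \<cdot>\<^bsub>Kl C T\<^esub> munit S X = \<alpha>"
    using S.munit_nat[OF \<alpha>] Kl.Comp_eq_extend[OF S.munit_left[OF \<alpha>'(4)], of \<alpha>] \<alpha>' by simp
  then show ?thesis
    unfolding a(2) using Kl.Comp_mono[OF e e a(1) star_hom[OF a(1)] Kl.le_refl[OF e] star_incl[OF a(1)]]
    by simp
qed

text \<open>Saturation for \<open>S'\<close> is monotone and idempotent, and
  \<open>n \<cdot> \<alpha>\<close> lies below \<open>n\<close> after the saturation of \<alpha>.
  The inequality \<open>le\<close>, restricted along the unit, puts the latter below the saturation
  of \<open>n \<cdot> \<alpha>\<close>, so the two saturations agree.\<close>

lemma saturate_along: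
  assumes S: "monad (Kl C T) S" and S': "monad (Kl C T) S'"
    and mono: "locally_monotonic (Kl C T) le S'" and compat: "saturation_compatible (Kl C T) star S'"
    and n: "n \<in> hom (Kl C T) (omap S X) (omap S' X)" "n \<cdot>\<^bsub>Kl C T\<^esub> munit S X = munit S' X"
    and \<alpha>: "\<alpha> \<in> hom (Kl C T) X (omap S X)"
    and le: "le (n \<cdot>\<^bsub>Kl C T\<^esub> star (mult S X \<cdot>\<^bsub>Kl C T\<^esub> amap S \<alpha>))
      (star (mult S' X \<cdot>\<^bsub>Kl C T\<^esub> amap S' (n \<cdot>\<^bsub>Kl C T\<^esub> \<alpha>)) \<cdot>\<^bsub>Kl C T\<^esub> n)"
  shows "saturate (Kl C T) star S' (n \<cdot>\<^bsub>Kl C T\<^esub> saturate (Kl C T) star S \<alpha>)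
    = saturate (Kl C T) star S' (n \<cdot>\<^bsub>Kl C T\<^esub> \<alpha>)"
proof -
  interpret S: monad "Kl C T" S by fact
  interpret S': monad "Kl C T" S' by fact
  let ?sat = "saturate (Kl C T) star"
  let ?u = "n \<cdot>\<^bsub>Kl C T\<^esub> \<alpha>" and ?v = "n \<cdot>\<^bsub>Kl C T\<^esub> ?sat S \<alpha>"
  have X: "X \<in> Ob (Kl C T)" using Kl.homD[OF \<alpha>] by simp
  note a = saturate_in_hom[OF S \<alpha>]
  have u: "?u \<in> hom (Kl C T) X (omap S' X)" and v: "?v \<in> hom (Kl C T) X (omap S' X)"
    using Kl.Comp_hom n \<alpha> a(3) by blast+
  note us = saturate_in_hom[OF S' u] and vs = saturate_in_hom[OF S' v]
  have sat_mono: "le (?sat S' x) (?sat S' y)"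
    if x: "x \<in> hom (Kl C T) X (omap S' X)" and y: "y \<in> hom (Kl C T) X (omap S' X)" and xy: "le x y" for x y
  proof -
    note xs = saturate_in_hom[OF S' x] and ys = saturate_in_hom[OF S' y]
    note m = S'.mult_hom[OF X] and e = S'.munit_hom[OF X]
    have "le (amap S' x) (amap S' y)" using mono x y xy unfolding locally_monotonic_def by blast
    from Kl.Comp_mono[OF S'.amap_hom[OF x] S'.amap_hom[OF y] m m this Kl.le_refl[OF m]]
    have "le (star (mult S' X \<cdot>\<^bsub>Kl C T\<^esub> amap S' x)) (star (mult S' X \<cdot>\<^bsub>Kl C T\<^esub> amap S' y))"
      by (rule star_mono[OF xs(1) ys(1)])
    from Kl.Comp_mono[OF e e star_hom[OF xs(1)] star_hom[OF ys(1)] Kl.le_refl[OF e] this]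
    show ?thesis by (simp add: xs(2) ys(2))
  qed
  \<comment> \<open>By \<open>compat\<close> the endomorphism induced by a saturated arrow is
    already a \<open>star\<close>, so the second saturation only applies \<open>star\<close>
    again.\<close>
  have idem: "?sat S' (?sat S' ?u) = ?sat S' ?u"
    using compat X u star_star[OF us(1)] saturate_in_hom(2)[OF S' us(3)]
    by (simp add: saturation_compatible_def us(2))
  have "le ?u ?v"
    by (rule Kl.Comp_mono[OF \<alpha> a(3) n(1) n(1) saturate_incl[OF S \<alpha>] Kl.le_refl[OF n(1)]])
  then have 1: "le (?sat S' ?u) (?sat S' ?v)" by (rule sat_mono[OF u v])
  note e = S.munit_hom[OF X]
  note sa = star_hom[OF a(1)] and su = star_hom[OF us(1)]
  \<comment> \<open>Since \<open>n\<close> carries the unit of \<open>S\<close> to that of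
    \<open>S'\<close>, precomposition with the unit turns both sides of \<open>le\<close> into
    saturated arrows, the left one followed by \<open>n\<close>.\<close>
  have "le ((n \<cdot>\<^bsub>Kl C T\<^esub> star (mult S X \<cdot>\<^bsub>Kl C T\<^esub> amap S \<alpha>)) \<cdot>\<^bsub>Kl C T\<^esub> munit S X)
      ((star (mult S' X \<cdot>\<^bsub>Kl C T\<^esub> amap S' ?u) \<cdot>\<^bsub>Kl C T\<^esub> n) \<cdot>\<^bsub>Kl C T\<^esub> munit S X)"
    by (rule Kl.Comp_mono[OF e e Kl.Comp_hom[OF sa n(1)] Kl.Comp_hom[OF n(1) su] Kl.le_refl[OF e] le])
  then have "le ?v (?sat S' ?u)"
    unfolding us(2) a(2) by (simp only: Kl.Comp_assoc[OF e sa n(1)] Kl.Comp_assoc[OF e n(1) su] n(2))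
  then have "le (?sat S' ?v) (?sat S' (?sat S' ?u))" by (rule sat_mono[OF v us(3)])
  with 1 show ?thesis unfolding idem using Kl.le_antisym[OF vs(3) us(3)] by blast
qed

end

section \<open>The comparison of the two saturations\<close>

context weak_bisimulation_setting
begin

abbreviation "K \<equiv> Kl C T"
abbreviation "PK \<equiv> Kl_coproducts C T P"
abbreviation "Ftau \<equiv> tau_monad K PK zero F'"
abbreviation "ne \<equiv> nu_e K PK Fst' \<nu>"

lemma PK_coproducts: "binary_coproducts K PK"
  by (rule Kl_binary_coproducts[OF binary_coproducts_axioms])

lemma PK_sel: "csum PK = csum P" "inj1 PK Y Z = sharp C T (inj1 P Y Z)"
    "inj2 PK Y Z = sharp C T (inj2 P Y Z)"
  by (simp_all add: Kl_coproducts_def)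

lemma omap_lifts:
  assumes "X \<in> Ob C"
  shows "omap F' X = omap F X" "omap Fst' X = fobj A X" "omap Ftau X = csum P (omap F X) X"
  using assms F_lifts Fst_lifts
  by (auto simp: lifts_def tau_monad_def plus_Id_def PK_sel free_monad_def)

lemma free_monad_amap_hom:
  "f \<in> hom C X Y \<Longrightarrow> amap (free_monad C F A) f \<in> hom C (fobj A X) (fobj A Y)"
  using Fs_amap by (auto simp: hom_def)

lemma plus_Id_amap_hom:
  "f \<in> hom C X Y \<Longrightarrow> amap (plus_Id C P F) f \<in> hom C (csum P (omap F X) X) (csum P (omap F Y) Y)"
  using sum_map(1)[OF amap_hom] by (simp add: plus_Id_def)

lemma amap_lifts:
  assumes f: "f \<in> hom C X Y"
  shows "amap F' (sharp C T f) = sharp C T (amap F f)"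
    "amap Fst' (sharp C T f) = sharp C T (amap (free_monad C F A) f)"
    "amap Ftau (sharp C T f) = sharp C T (amap (plus_Id C P F) f)"
proof -
  have "f \<in> Ar C" using homD[OF f] by simp
  then show 1: "amap F' (sharp C T f) = sharp C T (amap F f)"
    "amap Fst' (sharp C T f) = sharp C T (amap (free_monad C F A) f)"
    using F_lifts Fst_lifts by (auto simp: lifts_def)
  show "amap Ftau (sharp C T f) = sharp C T (amap (plus_Id C P F) f)"
    using sum_map_sharp[OF binary_coproducts_axioms amap_hom[OF f] f] 1
    by (simp add: tau_monad_def plus_Id_def)
qed

section \<open>The arrow \<open>ne X\<close>: naturality and factorization through the free
  algebra\<close>

lemma nu_e:
  assumes X: "X \<in> Ob C"
  shows "ne X \<in> hom K (omap Ftau X) (omap Fst' X)" "ne X \<cdot>\<^bsub>K\<^esub> munit Ftau X = munit Fst' X"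
    "ne X \<cdot>\<^bsub>K\<^esub> sharp C T (inj1 P (omap F X) X) = \<nu> X"
    "ne X \<cdot>\<^bsub>K\<^esub> sharp C T (inj2 P (omap F X) X) = munit Fst' X"
proof -
  interpret Q: binary_coproducts K PK by (rule PK_coproducts)
  have "\<nu> X \<in> hom K (omap F X) (omap Fst' X)" "munit Fst' X \<in> hom K X (omap Fst' X)"
    using naturalD(1-3)[OF Kl.nu_natural] Kl.M.munit_hom X omap_lifts
    by (auto simp: hom_def Kl_sel)
  from Q.cotuple[OF this]
  show "ne X \<in> hom K (omap Ftau X) (omap Fst' X)" "ne X \<cdot>\<^bsub>K\<^esub> munit Ftau X = munit Fst' X"
    "ne X \<cdot>\<^bsub>K\<^esub> sharp C T (inj1 P (omap F X) X) = \<nu> X"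
    "ne X \<cdot>\<^bsub>K\<^esub> sharp C T (inj2 P (omap F X) X) = munit Fst' X"
    using X omap_lifts by (simp_all add: nu_e_def PK_sel tau_monad_def)
qed

text \<open>On the first coprojection this is naturality of \<nu>, on the second naturality of the
  unit of \<open>Fst'\<close>.\<close>

lemma nu_e_natural:
  assumes f: "f \<in> hom C X Z"
  shows "ne Z \<cdot>\<^bsub>K\<^esub> sharp C T (amap (plus_Id C P F) f)
    = sharp C T (amap (free_monad C F A) f) \<cdot>\<^bsub>K\<^esub> ne X"
proof -
  interpret Q: binary_coproducts K PK by (rule PK_coproducts)
  note f' = homD[OF f] and fh = sharp_hom[OF f]
  let ?t = "sharp C T (amap (plus_Id C P F) f)" and ?s = "sharp C T (amap (free_monad C F A) f)"
  let ?Ff = "sharp C T (amap F f)"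
  have FX: "omap F X \<in> Ob C" "omap F Z \<in> Ob C" using f' omap_Ob by auto
  note iX = inj1_hom[OF FX(1) f'(4)] inj2_hom[OF FX(1) f'(4)]
  note iZ = inj1_hom[OF FX(2) f'(5)] inj2_hom[OF FX(2) f'(5)]
  note th = plus_Id_amap_hom[OF f]
  have t1: "?t \<cdot>\<^bsub>K\<^esub> sharp C T (inj1 P (omap F X) X) = sharp C T (inj1 P (omap F Z) Z) \<cdot>\<^bsub>K\<^esub> ?Ff"
    and t2: "?t \<cdot>\<^bsub>K\<^esub> sharp C T (inj2 P (omap F X) X) = sharp C T (inj2 P (omap F Z) Z) \<cdot>\<^bsub>K\<^esub> sharp C T f"
    using sharp_Comp[OF iX(1) th] sharp_Comp[OF iX(2) th] sharp_Comp[OF amap_hom[OF f] iZ(1)]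
      sharp_Comp[OF f iZ(2)] sum_map(2,3)[OF amap_hom[OF f] f] by (simp_all add: plus_Id_def)
  note nX = nu_e[OF f'(4), unfolded omap_lifts[OF f'(4)]] and nZ = nu_e[OF f'(5), unfolded omap_lifts[OF f'(5)]]
  note sh = sharp_hom[OF free_monad_amap_hom[OF f]] and th' = sharp_hom[OF th]
  note Ffh = sharp_hom[OF amap_hom[OF f]]
  note jX = sharp_hom[OF iX(1)] sharp_hom[OF iX(2)] and jZ = sharp_hom[OF iZ(1)] sharp_hom[OF iZ(2)]
  show ?thesis
  proof (rule Q.csum_ext[where X = "omap F X" and Y = X and Z = "fobj A Z"], unfold PK_sel)
    show "ne Z \<cdot>\<^bsub>K\<^esub> ?t \<in> hom K (csum P (omap F X) X) (fobj A Z)"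
      by (rule Kl.Comp_hom[OF th' nZ(1)])
    show "?s \<cdot>\<^bsub>K\<^esub> ne X \<in> hom K (csum P (omap F X) X) (fobj A Z)"
      by (rule Kl.Comp_hom[OF nX(1) sh])
    have "(ne Z \<cdot>\<^bsub>K\<^esub> ?t) \<cdot>\<^bsub>K\<^esub> sharp C T (inj1 P (omap F X) X) = \<nu> Z \<cdot>\<^bsub>K\<^esub> ?Ff"
      by (simp only: Kl.Comp_assoc[OF jX(1) th' nZ(1)] t1 Kl.Comp_assoc[OF Ffh jZ(1) nZ(1), symmetric] nZ(3))
    also have "\<dots> = ?s \<cdot>\<^bsub>K\<^esub> \<nu> X"
      using naturalD(4)[OF Kl.nu_natural, of "sharp C T f"] Kl.homD[OF fh] amap_lifts[OF f]
      by simp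
    also have "\<dots> = (?s \<cdot>\<^bsub>K\<^esub> ne X) \<cdot>\<^bsub>K\<^esub> sharp C T (inj1 P (omap F X) X)"
      by (simp only: Kl.Comp_assoc[OF jX(1) nX(1) sh] nX(3))
    finally show "(ne Z \<cdot>\<^bsub>K\<^esub> ?t) \<cdot>\<^bsub>K\<^esub> sharp C T (inj1 P (omap F X) X)
      = (?s \<cdot>\<^bsub>K\<^esub> ne X) \<cdot>\<^bsub>K\<^esub> sharp C T (inj1 P (omap F X) X)" .
    have "(ne Z \<cdot>\<^bsub>K\<^esub> ?t) \<cdot>\<^bsub>K\<^esub> sharp C T (inj2 P (omap F X) X) = munit Fst' Z \<cdot>\<^bsub>K\<^esub> sharp C T f"
      by (simp only: Kl.Comp_assoc[OF jX(2) th' nZ(1)] t2 Kl.Comp_assoc[OF fh jZ(2) nZ(1), symmetric] nZ(4))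
    also have "\<dots> = ?s \<cdot>\<^bsub>K\<^esub> munit Fst' X"
      using Kl.M.munit_nat[OF fh] amap_lifts[OF f] by simp
    also have "\<dots> = (?s \<cdot>\<^bsub>K\<^esub> ne X) \<cdot>\<^bsub>K\<^esub> sharp C T (inj2 P (omap F X) X)"
      by (simp only: Kl.Comp_assoc[OF jX(2) nX(1) sh] nX(4))
    finally show "(ne Z \<cdot>\<^bsub>K\<^esub> ?t) \<cdot>\<^bsub>K\<^esub> sharp C T (inj2 P (omap F X) X)
      = (?s \<cdot>\<^bsub>K\<^esub> ne X) \<cdot>\<^bsub>K\<^esub> sharp C T (inj2 P (omap F X) X)" .
  qed (use f' FX in \<open>simp_all add: Kl_sel\<close>)
qed

text \<open>\<open>s\<close> is the isomorphism given by uniqueness of free monads in the Kleisli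
  category. It takes generators to the unit and one layer of \<open>F\<close> over them to \<nu>, so
  \<open>ne X\<close> is \<open>s\<close> after a cotuple formed in \<open>C\<close>.\<close>

lemma nu_e_iso_sharp:
  assumes X: "X \<in> Ob C"
  obtains k s t where "k \<in> hom C (omap Ftau X) (fobj A X)"
    "s \<in> hom K (fobj A X) (omap Fst' X)" "t \<in> hom K (omap Fst' X) (fobj A X)"
    "s \<cdot>\<^bsub>K\<^esub> t = Idt K (omap Fst' X)" "t \<cdot>\<^bsub>K\<^esub> s = Idt K (fobj A X)" "ne X = s \<cdot>\<^bsub>K\<^esub> sharp C T k"
proof -
  interpret Q: binary_coproducts K PK by (rule PK_coproducts)
  have "X \<in> Ob K" using X by (simp add: Kl_sel)
  from free_monad_over_iso[OF Kl.free_monad_over_axioms Kl_free_algebras[OF free_algebras_axioms F_lifts] this]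
  obtain s t where s: "s \<in> hom K (fobj A X) (omap Fst' X)" and t: "t \<in> hom K (omap Fst' X) (fobj A X)"
    and st: "s \<cdot>\<^bsub>K\<^esub> t = Idt K (omap Fst' X)" "t \<cdot>\<^bsub>K\<^esub> s = Idt K (fobj A X)"
    and e: "s \<cdot>\<^bsub>K\<^esub> sharp C T (funit A X) = munit Fst' X"
    and n: "s \<cdot>\<^bsub>K\<^esub> sharp C T (fstr A X) \<cdot>\<^bsub>K\<^esub> amap F' (sharp C T (funit A X)) = \<nu> X"
    by (auto simp: Kl_free_algs_def)
  have FX: "omap F X \<in> Ob C" using X omap_Ob by simp
  note u = funit_hom[OF X]
  note nu = Comp_hom[OF amap_hom[OF u] fstr_hom[OF X]]
  \<comment> \<open>The counterpart of \<open>ne X\<close> in \<open>C\<close>: one layer of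
    \<open>F\<close> over generators on the left summand, generators on the right.\<close>
  define k where "k = cotuple C P (fstr A X \<cdot> amap F (funit A X)) (funit A X)"
  note k = cotuple[OF nu u, folded k_def]
  note i = inj1_hom[OF FX X] inj2_hom[OF FX X]
  have k1: "sharp C T k \<cdot>\<^bsub>K\<^esub> sharp C T (inj1 P (omap F X) X) = sharp C T (fstr A X) \<cdot>\<^bsub>K\<^esub> amap F' (sharp C T (funit A X))"
    using sharp_Comp[OF i(1) k(1)] k(2) sharp_Comp[OF amap_hom[OF u] fstr_hom[OF X]] amap_lifts(1)[OF u] by simp
  have k2: "sharp C T k \<cdot>\<^bsub>K\<^esub> sharp C T (inj2 P (omap F X) X) = sharp C T (funit A X)"
    using sharp_Comp[OF i(2) k(1)] k(3) by simp
  note ne = nu_e[OF X, unfolded omap_lifts(3)[OF X]] and kh = sharp_hom[OF k(1)]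
  note j = sharp_hom[OF i(1)] sharp_hom[OF i(2)]
  have "ne X = s \<cdot>\<^bsub>K\<^esub> sharp C T k"
  proof (rule Q.csum_ext[where X = "omap F X" and Y = X and Z = "omap Fst' X"], unfold PK_sel)
    show "ne X \<in> hom K (csum P (omap F X) X) (omap Fst' X)" by (rule ne(1))
    show "s \<cdot>\<^bsub>K\<^esub> sharp C T k \<in> hom K (csum P (omap F X) X) (omap Fst' X)"
      by (rule Kl.Comp_hom[OF kh s])
    show "ne X \<cdot>\<^bsub>K\<^esub> sharp C T (inj1 P (omap F X) X) = (s \<cdot>\<^bsub>K\<^esub> sharp C T k) \<cdot>\<^bsub>K\<^esub> sharp C T (inj1 P (omap F X) X)"
      by (simp only: Kl.Comp_assoc[OF j(1) kh s] k1 n ne(3))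
    show "ne X \<cdot>\<^bsub>K\<^esub> sharp C T (inj2 P (omap F X) X) = (s \<cdot>\<^bsub>K\<^esub> sharp C T k) \<cdot>\<^bsub>K\<^esub> sharp C T (inj2 P (omap F X) X)"
      by (simp only: Kl.Comp_assoc[OF j(2) kh s] k2 e ne(4))
  qed (use X FX in \<open>simp_all add: Kl_sel\<close>)
  then show thesis using that[OF _ s t st] k(1) omap_lifts(3)[OF X] by simp
qed

text \<open>The factorization of \<open>ne X\<close> lets \<open>star_le_iso\<close> carry
  \<open>le\<close> over to the \<open>star\<close> arrows; the result is the inequality required by
  \<open>saturate_along\<close>.\<close>

lemma saturate_nu_e:
  assumes X: "X \<in> Ob C" and \<alpha>: "\<alpha> \<in> hom K X (omap Ftau X)"
    and le: "le (ne X \<cdot>\<^bsub>K\<^esub> mult Ftau X \<cdot>\<^bsub>K\<^esub> amap Ftau \<alpha>)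
      (mult Fst' X \<cdot>\<^bsub>K\<^esub> amap Fst' (ne X \<cdot>\<^bsub>K\<^esub> \<alpha>) \<cdot>\<^bsub>K\<^esub> ne X)"
  shows "saturate K star Fst' (ne X \<cdot>\<^bsub>K\<^esub> saturate K star Ftau \<alpha>) = saturate K star Fst' (ne X \<cdot>\<^bsub>K\<^esub> \<alpha>)"
proof -
  obtain k s t where k: "k \<in> hom C (omap Ftau X) (fobj A X)"
    "s \<in> hom K (fobj A X) (omap Fst' X)" "t \<in> hom K (omap Fst' X) (fobj A X)"
    "s \<cdot>\<^bsub>K\<^esub> t = Idt K (omap Fst' X)" "t \<cdot>\<^bsub>K\<^esub> s = Idt K (fobj A X)" "ne X = s \<cdot>\<^bsub>K\<^esub> sharp C T k"
    using nu_e_iso_sharp[OF X] by blast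
  note M = Kl.M.monad_axioms
  note n = nu_e[OF X]
  have u: "ne X \<cdot>\<^bsub>K\<^esub> \<alpha> \<in> hom K X (omap Fst' X)" by (rule Kl.Comp_hom[OF \<alpha> n(1)])
  note a = saturate_in_hom(1)[OF Ftau_monad \<alpha>] and b = saturate_in_hom(1)[OF M u]
  have "mult Fst' X \<in> hom K (omap Fst' (omap Fst' X)) (omap Fst' X)"
    using Kl.M.mult_hom X by (simp add: Kl_sel)
  from Kl.Comp_assoc[OF n(1) Kl.M.amap_hom[OF u] this] le
  have "le (ne X \<cdot>\<^bsub>K\<^esub> (mult Ftau X \<cdot>\<^bsub>K\<^esub> amap Ftau \<alpha>))
      ((mult Fst' X \<cdot>\<^bsub>K\<^esub> amap Fst' (ne X \<cdot>\<^bsub>K\<^esub> \<alpha>)) \<cdot>\<^bsub>K\<^esub> ne X)" by simp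
  from saturate_along[OF Ftau_monad M Fst_monotonic Fst_compatible n(1,2) \<alpha> star_le_iso[OF k a b this]]
  show ?thesis .
qed

section \<open>Coalgebras over \<open>C\<close> as Kleisli arrows, and the transfer of
  bisimulations\<close>

lemma Kl_coalgebra_hom_iff:
  assumes f: "f \<in> hom C X Z" and h: "amap G f \<in> hom C (omap G X) (omap G Z)"
    and \<alpha>: "\<alpha> \<in> hom K X (omap G X)" and \<gamma>: "\<gamma> \<in> hom K Z (omap G Z)"
  shows "coalgebra_hom C (comp_endo T G) X (underlying \<alpha>) Z (underlying \<gamma>) f
    \<longleftrightarrow> sharp C T (amap G f) \<cdot>\<^bsub>K\<^esub> \<alpha> = \<gamma> \<cdot>\<^bsub>K\<^esub> sharp C T f"
proof -
  obtain a where a: "\<alpha> = (X, a, omap G X)" "a \<in> hom C X (omap T (omap G X))"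
    using \<alpha> by (auto simp: Kl_hom)
  obtain c where c: "\<gamma> = (Z, c, omap G Z)" "c \<in> hom C Z (omap T (omap G Z))"
    using \<gamma> by (auto simp: Kl_hom)
  \<comment> \<open>Composition with a pure arrow on either side involves no multiplication, so the
    two squares have the same underlying arrows.\<close>
  show ?thesis
    using sharp_comp_left[OF a(2) h] sharp_comp_right[OF f c(2)] homD[OF h] f
    by (simp add: a(1) c(1) coalgebra_hom_def comp_endo_def underlying_def)
qed

lemma Kl_coalgebra_iff:
  assumes "X \<in> Ob C" "omap G X \<in> Ob C"
  shows "coalgebra C (comp_endo T G) X a \<longleftrightarrow> (X, a, omap G X) \<in> hom K X (omap G X)"
  using assms by (simp add: coalgebra_def comp_endo_def Kl_hom)

text \<open>The cospan is kept and only its target structure changes, to the saturation of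
  \<open>ne Z \<cdot> \<gamma>\<close>. Pullback and joint monicity speak of \<open>f\<close>,
  \<open>g\<close>, \<open>p\<close> and \<open>q\<close> alone and persist.\<close>

theorem bisimulation_saturate:
  assumes X: "X \<in> Ob C" and \<alpha>: "\<alpha> \<in> hom K X (omap Ftau X)"
    and le: "le (ne X \<cdot>\<^bsub>K\<^esub> mult Ftau X \<cdot>\<^bsub>K\<^esub> amap Ftau \<alpha>)
      (mult Fst' X \<cdot>\<^bsub>K\<^esub> amap Fst' (ne X \<cdot>\<^bsub>K\<^esub> \<alpha>) \<cdot>\<^bsub>K\<^esub> ne X)"
    and bisim: "bisimulation_on C (comp_endo T (plus_Id C P F)) X
      (underlying (saturate K star Ftau \<alpha>)) R p q"
  shows "bisimulation_on C (comp_endo T (free_monad C F A)) X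
      (underlying (saturate K star Fst' (ne X \<cdot>\<^bsub>K\<^esub> \<alpha>))) R p q"
proof -
  let ?G = "plus_Id C P F" and ?H = "free_monad C F A"
  note M = Kl.M.monad_axioms
  \<comment> \<open>A lifting prescribes \<open>omap\<close> on objects of \<open>C\<close> only,
    hence the condition on \<open>Y\<close>.\<close>
  have om: "omap ?G Y = omap Ftau Y" "omap ?H Y = omap Fst' Y" if "Y \<in> Ob C" for Y
    using omap_lifts[OF that] by (simp_all add: plus_Id_def free_monad_def)
  define \<beta> where "\<beta> = saturate K star Ftau \<alpha>"
  have \<beta>: "\<beta> \<in> hom K X (omap Ftau X)" unfolding \<beta>_def by (rule saturate_in_hom(3)[OF Ftau_monad \<alpha>])
  define \<delta> where "\<delta> = saturate K star Fst' (ne X \<cdot>\<^bsub>K\<^esub> \<beta>)"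
  \<comment> \<open>The given homomorphisms start from \<beta> and not from \<alpha>, so the
    coalgebra of the claim is rewritten in terms of \<beta>.\<close>
  have \<delta>_eq: "saturate K star Fst' (ne X \<cdot>\<^bsub>K\<^esub> \<alpha>) = \<delta>"
    unfolding \<delta>_def \<beta>_def by (rule saturate_nu_e[OF X \<alpha> le, symmetric])
  obtain Z c f g where c: "coalgebra C (comp_endo T ?G) Z c"
    and fc: "coalgebra_hom C (comp_endo T ?G) X (underlying \<beta>) Z c f"
    and gc: "coalgebra_hom C (comp_endo T ?G) X (underlying \<beta>) Z c g" and pb: "pullback C f g R p q"
    using bisim unfolding bisimulation_def \<beta>_def by blast
  have Z: "Z \<in> Ob C" using c by (simp add: coalgebra_def)
  define \<gamma> where "\<gamma> = (Z, c, omap Ftau Z)"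
  have \<gamma>: "\<gamma> \<in> hom K Z (omap Ftau Z)" "underlying \<gamma> = c"
    using c Kl_coalgebra_iff[OF Z, of ?G c] om[OF Z] omap_lifts(3)[OF Z] csum_Ob[OF omap_Ob[OF Z] Z]
    by (simp_all add: \<gamma>_def underlying_def)
  have ns: "ne Y \<cdot>\<^bsub>K\<^esub> \<phi> \<in> hom K Y (omap Fst' Y)" if "\<phi> \<in> hom K Y (omap Ftau Y)" "Y \<in> Ob C" for \<phi> Y
    using Kl.Comp_hom[OF that(1) nu_e(1)[OF that(2)]] .
  define \<epsilon> where "\<epsilon> = saturate K star Fst' (ne Z \<cdot>\<^bsub>K\<^esub> \<gamma>)"
  have \<delta>: "\<delta> \<in> hom K X (omap Fst' X)" and \<epsilon>: "\<epsilon> \<in> hom K Z (omap Fst' Z)"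
    unfolding \<delta>_def \<epsilon>_def using saturate_in_hom(3)[OF M ns] \<beta> \<gamma> X Z by blast+
  \<comment> \<open>For either leg \<open>h\<close>, \<open>nu_e_natural\<close> moves the square
    from \<beta> and \<gamma> to \<open>ne X \<cdot> \<beta>\<close> and
    \<open>ne Z \<cdot> \<gamma>\<close>, and saturation preserves it.\<close>
  have hom: "coalgebra_hom C (comp_endo T ?H) X (underlying \<delta>) Z (underlying \<epsilon>) h"
    if hc: "coalgebra_hom C (comp_endo T ?G) X (underlying \<beta>) Z c h" for h
  proof -
    have h: "h \<in> hom C X Z" using hc by (simp add: coalgebra_hom_def)
    let ?t = "sharp C T (amap ?G h)" and ?s = "sharp C T (amap ?H h)"
    have Gh: "amap ?G h \<in> hom C (omap Ftau X) (omap Ftau Z)"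
      and Hh: "amap ?H h \<in> hom C (omap Fst' X) (omap Fst' Z)"
      using plus_Id_amap_hom[OF h] free_monad_amap_hom[OF h] omap_lifts[OF X] omap_lifts[OF Z] by simp_all
    have 1: "?t \<cdot>\<^bsub>K\<^esub> \<beta> = \<gamma> \<cdot>\<^bsub>K\<^esub> sharp C T h"
      using Kl_coalgebra_hom_iff[OF h, of ?G \<beta> \<gamma>] hc Gh \<beta> \<gamma> om[OF X] om[OF Z] by simp
    note th = sharp_hom[OF Gh] and sh = sharp_hom[OF Hh] and hh = sharp_hom[OF h]
    note nX = nu_e(1)[OF X] and nZ = nu_e(1)[OF Z]
    have "?s \<cdot>\<^bsub>K\<^esub> ne X \<cdot>\<^bsub>K\<^esub> \<beta> = (?s \<cdot>\<^bsub>K\<^esub> ne X) \<cdot>\<^bsub>K\<^esub> \<beta>"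
      by (rule Kl.Comp_assoc[OF \<beta> nX sh, symmetric])
    also have "\<dots> = ne Z \<cdot>\<^bsub>K\<^esub> ?t \<cdot>\<^bsub>K\<^esub> \<beta>"
      unfolding nu_e_natural[OF h, symmetric] by (rule Kl.Comp_assoc[OF \<beta> th nZ])
    also have "\<dots> = (ne Z \<cdot>\<^bsub>K\<^esub> \<gamma>) \<cdot>\<^bsub>K\<^esub> sharp C T h"
      unfolding 1 by (rule Kl.Comp_assoc[OF hh \<gamma>(1) nZ, symmetric])
    finally have "?s \<cdot>\<^bsub>K\<^esub> \<delta> = \<epsilon> \<cdot>\<^bsub>K\<^esub> sharp C T h"
      unfolding \<delta>_def \<epsilon>_def
      by (rule saturate_preserves_hom[OF M h Hh amap_lifts(2)[OF h] ns[OF \<beta> X] ns[OF \<gamma>(1) Z]])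
    then show ?thesis
      using Kl_coalgebra_hom_iff[OF h, of ?H \<delta> \<epsilon>] Hh \<delta> \<epsilon> om[OF X] om[OF Z] by simp
  qed
  have "coalgebra C (comp_endo T ?H) X (underlying \<delta>)" "coalgebra C (comp_endo T ?H) Z (underlying \<epsilon>)"
    using \<delta> \<epsilon> X Z om[OF X] om[OF Z] by (auto simp: coalgebra_def comp_endo_def Kl_hom underlying_def)
  then show ?thesis
    unfolding \<delta>_eq using bisim hom[OF fc] hom[OF gc] pb unfolding bisimulation_def by blast
qed

end

theorem theorem7:
  fixes C :: "('o, 'a) category"
    and T :: "('o, 'a) monad"
    and le :: "'o \<times> 'a \<times> 'o \<Rightarrow> 'o \<times> 'a \<times> 'o \<Rightarrow> bool"
    and star :: "'o \<times> 'a \<times> 'o \<Rightarrow> 'o \<times> 'a \<times> 'o"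
    and P :: "('o, 'a) coproducts"
    and zero :: "'o \<Rightarrow> 'o \<Rightarrow> 'o \<times> 'a \<times> 'o"
    and F :: "('o, 'a) endo"
    and A :: "('o, 'a) free_algs"
    and F' :: "('o, 'o \<times> 'a \<times> 'o) endo"
    and Fst' :: "('o, 'o \<times> 'a \<times> 'o) monad"
    and \<nu> :: "'o \<Rightarrow> 'o \<times> 'a \<times> 'o"
    and K :: "('o, 'o \<times> 'a \<times> 'o) category"
    and PK :: "('o, 'o \<times> 'a \<times> 'o) coproducts"
    and Ftau' :: "('o, 'o \<times> 'a \<times> 'o) monad"
    and ne :: "'o \<times> 'a \<times> 'o"
    and X R :: 'o
    and \<alpha> \<alpha>u :: "'o \<times> 'a \<times> 'o"
    and p q :: 'a
  assumes setting: "weak_bisimulation_setting C T le star P zero F A F' Fst' \<nu>"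
    and K: "K = Kl C T"
    and PK: "PK = Kl_coproducts C T P"
    and Ftau': "Ftau' = tau_monad K PK zero F'"
    and ne: "ne = nu_e K PK Fst' \<nu> X"
    and \<alpha>u: "\<alpha>u = ne \<cdot>\<^bsub>K\<^esub> \<alpha>"
    and X: "X \<in> Ob C"
    and \<alpha>: "\<alpha> \<in> hom K X (omap Ftau' X)"
    and le: "le (ne \<cdot>\<^bsub>K\<^esub> mult Ftau' X \<cdot>\<^bsub>K\<^esub> amap Ftau' \<alpha>)
                (mult Fst' X \<cdot>\<^bsub>K\<^esub> amap Fst' \<alpha>u \<cdot>\<^bsub>K\<^esub> ne)"
    and bisim: "bisimulation_on C (comp_endo T (plus_Id C P F)) X
                  (underlying (saturate K star Ftau' \<alpha>)) R p q"
  shows "bisimulation_on C (comp_endo T (free_monad C F A)) X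
           (underlying (saturate K star Fst' \<alpha>u)) R p q"
proof -
  interpret weak_bisimulation_setting C T le star P zero F A F' Fst' \<nu> by (rule setting)
  show ?thesis
    using bisimulation_saturate[OF X, of \<alpha> R p q] \<alpha> le bisim
    unfolding \<alpha>u ne Ftau' PK K by blast
qed

end
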